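(* (High-frequency stability criteria) Let $F>2$ and let $W=(H,Q)$ be any ($X$-periodic) roll wave of the inviscid Saint-Venant equations, with periodic Evans-Lopatinsky determinant $\Delta(\lambda,\xi)$. Then: (i) the (potential) unstable spectrum of $W$, i.e. the set of $\lambda$ with $\Re(\lambda)>0$ such that $\Delta(\lambda,\xi)=0$ for some $\xi\in[-\pi/X,\pi/X]$, has bounded real part; (ii) there is an explicitly calculable stability index $\mathbf{I}$, namely $$\mathbf{I}=\left(\frac{\frac{\sqrt{H_-}}{F}+\frac{q_0}{H_-}}{\frac{\sqrt{H_+}}{F}+\frac{q_0}{H_+}}\right)^2e^{-\int_0^X\tilde\gamma_+(y)\,dy},$$ such that when $\mathbf{I}<1$ the (potential) unstable spectrum is bounded, whereas when $\mathbf{I}>1$ there is an unbounded curve of unstable Floquet eigenvalues asymptotic to $\Re\lambda=\eta$ as $|\lambda|\to\infty$, for some $\eta>0$.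
   Context: Equations. The inviscid Saint-Venant equations are $\partial_t h+\partial_x q=0$, $\partial_t q+\partial_x\big(\tfrac{q^2}{h}+\tfrac{h^2}{2F^2}\big)=h-\tfrac{|q|q}{h^2}$, with Froude number $F$. Roll waves. Fix $F>2$. A roll wave is determined by $H_s>0$ and $H_-$ with $\frac{1+2F+\sqrt{1+4F}}{2F^2}H_s<H_-<H_s$. Put $q_0=H_s^{3/2}/F$, $c=H_s^{1/2}(1+1/F)$, and let $H_+>H_s$ be the unique solution of $\frac{q_0^2}{H_+}+\frac{H_+^2}{2F^2}=\frac{q_0^2}{H_-}+\frac{H_-^2}{2F^2}$. Let $H:[0,X]\to[H_-,H_+]$ be the (increasing) solution of $H'=F^2\,\frac{H^2+(H_s-c^2)H+q_0^2/H_s}{H^2+H_sH+H_s^2}$ with $H(0)=H_-$, where $X>0$ is determined by $H(X)=H_+$, and let $Q=cH-q_0$. The $X$-periodic extension of $(H,Q)|_{(0,X)}$, with shocks at $jX$, $j\in\mathbb{Z}$, is the profile $W$, and $(h,q)(x,t)=(H,Q)(x-ct)$ is the roll wave. Let $x_s\in(0,X)$ be the sonic point, where $H(x_s)=H_s$. Interior eigenvalue equations. For $\lambda\in\mathbb{C}$, consider on $(0,X)$ $$\lambda h+\partial_x(-ch+q)=0,\qquad \lambda q+\partial_x\Big(\big(\tfrac{2Q}{H}-c\big)q+\big(-\tfrac{Q^2}{H^2}+\tfrac{H}{F^2}\big)h\Big)=h-\tfrac{2Q}{H^2}q+\tfrac{2Q^2}{H^3}h.$$ This system is singular at $x_s$.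 For $\Re(\lambda)>-\tfrac{F-2}{2\sqrt{H_s}}$ its space of analytic solutions on the closed cell is one-dimensional; $(h,q)=(h,q)(\cdot;\lambda)$ denotes the analytic solution (depending analytically on $\lambda$) normalized by $$\begin{pmatrix}h\\ q\end{pmatrix}(x_s)=\frac{F-2}{2(F+1)}\sqrt{H_s}\begin{pmatrix}\big(\lambda+\tfrac23\tfrac{F+1}{\sqrt{H_s}}\big)F\\ \lambda\sqrt{H_s}(F-1)+\tfrac23(F+1)^2\end{pmatrix}.$$ Evans-Lopatinsky determinant. For $\Re(\lambda)>-\tfrac{F-2}{2\sqrt{H_s}}$ and $\xi\in[-\pi/X,\pi/X]$, with $\{f\}:=f(X^-)-f(0^+)$ and $\{f\}_\xi:=f(X^-)-e^{i\xi X}f(0^+)$, $$\Delta(\lambda,\xi):=\det\begin{pmatrix}\{\lambda H\}&\{-ch+q\}_\xi\\ \{\lambda Q-(H-\tfrac{Q^2}{H^2})\}&\{(-\tfrac{Q^2}{H^2}+\tfrac{H}{F^2})h+(\tfrac{2Q}{H}-c)q\}_\xi\end{pmatrix}.$$ A Floquet eigenvalue is a root $\lambda$ of $\Delta(\cdot,\xi)$ for some $\xi\in[-\pi/X,\pi/X]$; it is unstable if $\Re(\lambda)>0$. Definition of $\tilde\gamma_+$. Let $p'(H)=H/F^2$, $m(x)=p'(H)-q_0^2/H^2$ (which vanishes on $[0,X]$ only at $x_s$), $r(h,q)=h-q^2/h^2$, and $$B_1=\begin{pmatrix}0&0\\ -\partial_qr(H,Q)-\big(\tfrac{2q_0}{H}\big)'&-m'+\partial_hr(H,Q)+c\,\partial_qr(H,Q)\end{pmatrix},\quad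 P_0=\begin{pmatrix}\tfrac{q_0}{H}+\sqrt{p'(H)}&\tfrac{q_0}{H}-\sqrt{p'(H)}\\1&1\end{pmatrix},$$ where $'$ denotes $d/dx$ (for functions of $x$), and $C_0=P_0^{-1}B_1P_0-m\,P_0^{-1}(P_0)'$. The entry $(C_0)_{1,1}$ vanishes at $x_s$, and $\tilde\gamma_+$ is the smooth function on $[0,X]$ defined by $(C_0)_{1,1}=m\,\tilde\gamma_+$. *)

theory Defs
  imports "HOL-Analysis.Analysis"
begin

section \<open>Roll waves\<close>

text \<open>
  A roll wave is given by the Froude number \<open>F\<close>, the sonic height \<open>Hs\<close>, the heights
  \<open>Hm < Hs < Hp\<close> at the two ends of the cell, the period \<open>X\<close>, and the height profile \<open>H\<close>, of which
  only the values on the closed cell \<open>{0..X}\<close> are used.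
\<close>

definition wave_flux :: "real \<Rightarrow> real \<Rightarrow> real"  \<comment> \<open>the constant \<open>q\<^sub>0 = c H - Q\<close>\<close>
  where "wave_flux F Hs = Hs powr (3/2) / F"

definition wave_speed :: "real \<Rightarrow> real \<Rightarrow> real"
  where "wave_speed F Hs = sqrt Hs * (1 + 1 / F)"

definition roll_wave ::
    "real \<Rightarrow> real \<Rightarrow> real \<Rightarrow> real \<Rightarrow> real \<Rightarrow> (real \<Rightarrow> real) \<Rightarrow> bool"
  where "roll_wave F Hs Hm Hp X H \<longleftrightarrow>
    Hs > 0 \<and>
    (1 + 2 * F + sqrt (1 + 4 * F)) / (2 * F\<^sup>2) * Hs < Hm \<and> Hm < Hs \<and>
    Hs < Hp \<and>
    (wave_flux F Hs)\<^sup>2 / Hp + Hp\<^sup>2 / (2 * F\<^sup>2) = (wave_flux F Hs)\<^sup>2 / Hm + Hm\<^sup>2 / (2 * F\<^sup>2) \<and>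
    X > 0 \<and> H 0 = Hm \<and> H X = Hp \<and>
    H ` {0..X} \<subseteq> {Hm..Hp} \<and> strict_mono_on {0..X} H \<and>
    (\<forall>x\<in>{0..X}.
      (H has_real_derivative
        F\<^sup>2 * (((H x)\<^sup>2 + (Hs - (wave_speed F Hs)\<^sup>2) * H x + (wave_flux F Hs)\<^sup>2 / Hs) /
              ((H x)\<^sup>2 + Hs * H x + Hs\<^sup>2)))
      (at x within {0..X}))"

definition discharge :: "real \<Rightarrow> real \<Rightarrow> (real \<Rightarrow> real) \<Rightarrow> real \<Rightarrow> real"
  where "discharge F Hs H x = wave_speed F Hs * H x - wave_flux F Hs"


section \<open>Interior eigenvalue equations\<close>

text \<open>The coefficients \<open>2Q/H - c\<close> of \<open>q\<close> and \<open>- Q\<^sup>2/H\<^sup>2 + H/F\<^sup>2\<close> of \<open>h\<close> in the linearized second flux.\<close>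

definition flux_coeff_q :: "real \<Rightarrow> real \<Rightarrow> (real \<Rightarrow> real) \<Rightarrow> real \<Rightarrow> real"
  where "flux_coeff_q F Hs H x = 2 * discharge F Hs H x / H x - wave_speed F Hs"

definition flux_coeff_h :: "real \<Rightarrow> real \<Rightarrow> (real \<Rightarrow> real) \<Rightarrow> real \<Rightarrow> real"
  where "flux_coeff_h F Hs H x = - (discharge F Hs H x)\<^sup>2 / (H x)\<^sup>2 + H x / F\<^sup>2"

definition lin_flux1 ::
    "real \<Rightarrow> real \<Rightarrow> (real \<Rightarrow> complex) \<Rightarrow> (real \<Rightarrow> complex) \<Rightarrow> real \<Rightarrow> complex"
  where "lin_flux1 F Hs h q x = - of_real (wave_speed F Hs) * h x + q x"

definition lin_flux2 ::
    "real \<Rightarrow> real \<Rightarrow> (real \<Rightarrow> real) \<Rightarrow> (real \<Rightarrow> complex) \<Rightarrow> (real \<Rightarrow> complex) \<Rightarrow> real \<Rightarrow> complex"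
  where "lin_flux2 F Hs H h q x =
    of_real (flux_coeff_q F Hs H x) * q x + of_real (flux_coeff_h F Hs H x) * h x"

definition eigen_system ::
    "real \<Rightarrow> real \<Rightarrow> real \<Rightarrow> (real \<Rightarrow> real) \<Rightarrow> complex \<Rightarrow> (real \<Rightarrow> complex) \<Rightarrow> (real \<Rightarrow> complex) \<Rightarrow> bool"
  where "eigen_system F Hs X H z h q \<longleftrightarrow> (\<forall>x\<in>{0<..<X}.
    lin_flux1 F Hs h q differentiable (at x) \<and>
    lin_flux2 F Hs H h q differentiable (at x) \<and>
    z * h x + vector_derivative (lin_flux1 F Hs h q) (at x) = 0 \<and>
    z * q x + vector_derivative (lin_flux2 F Hs H h q) (at x) =
      h x - of_real (2 * discharge F Hs H x / (H x)\<^sup>2) * q x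
          + of_real (2 * (discharge F Hs H x)\<^sup>2 / (H x)^3) * h x)"

text \<open>Real analyticity on a set of reals, up to and including its boundary points, expressed as
  the existence of a holomorphic extension to a complex neighbourhood.\<close>

definition real_analytic_on :: "(real \<Rightarrow> complex) \<Rightarrow> real set \<Rightarrow> bool"
  where "real_analytic_on f S \<longleftrightarrow>
    (\<exists>g. g analytic_on (complex_of_real ` S) \<and> (\<forall>x\<in>S. g (of_real x) = f x))"

definition spectral_domain :: "real \<Rightarrow> real \<Rightarrow> complex set"
  where "spectral_domain F Hs = {z. Re z > - (F - 2) / (2 * sqrt Hs)}"

text \<open>The analytic solutions \<open>(h z, q z)\<close>, normalized at the sonic point \<open>xs\<close> and depending
  analytically on the spectral parameter \<open>z\<close>.\<close>

definition normalized_solution ::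
    "real \<Rightarrow> real \<Rightarrow> real \<Rightarrow> (real \<Rightarrow> real) \<Rightarrow> real \<Rightarrow>
     (complex \<Rightarrow> real \<Rightarrow> complex) \<Rightarrow> (complex \<Rightarrow> real \<Rightarrow> complex) \<Rightarrow> bool"
  where "normalized_solution F Hs X H xs h q \<longleftrightarrow>
    (\<forall>z\<in>spectral_domain F Hs.
      real_analytic_on (h z) {0..X} \<and> real_analytic_on (q z) {0..X} \<and>
      eigen_system F Hs X H z (h z) (q z) \<and>
      h z xs = of_real ((F - 2) / (2 * (F + 1)) * sqrt Hs) *
               ((z + of_real (2/3 * ((F + 1) / sqrt Hs))) * of_real F) \<and>
      q z xs = of_real ((F - 2) / (2 * (F + 1)) * sqrt Hs) *
               (z * of_real (sqrt Hs * (F - 1)) + of_real (2/3 * (F + 1)\<^sup>2))) \<and>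
    (\<forall>x\<in>{0..X}.
      (\<lambda>z. h z x) analytic_on spectral_domain F Hs \<and>
      (\<lambda>z. q z x) analytic_on spectral_domain F Hs)"


section \<open>The periodic Evans-Lopatinsky determinant\<close>

definition jump :: "real \<Rightarrow> (real \<Rightarrow> complex) \<Rightarrow> complex"
  where "jump X f = Lim (at_left X) f - Lim (at_right 0) f"

definition bloch_jump :: "real \<Rightarrow> real \<Rightarrow> (real \<Rightarrow> complex) \<Rightarrow> complex"
  where "bloch_jump X \<xi> f = Lim (at_left X) f - exp (\<i> * of_real (\<xi> * X)) * Lim (at_right 0) f"

definition evans_lopatinsky ::
    "real \<Rightarrow> real \<Rightarrow> real \<Rightarrow> (real \<Rightarrow> real) \<Rightarrow>
     (complex \<Rightarrow> real \<Rightarrow> complex) \<Rightarrow> (complex \<Rightarrow> real \<Rightarrow> complex) \<Rightarrow> complex \<Rightarrow> real \<Rightarrow> complex"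
  where "evans_lopatinsky F Hs X H h q z \<xi> = det (vector
    [vector [jump X (\<lambda>x. z * of_real (H x)),
             bloch_jump X \<xi> (lin_flux1 F Hs (h z) (q z))],
     vector [jump X (\<lambda>x. z * of_real (discharge F Hs H x)
                         - of_real (H x - (discharge F Hs H x)\<^sup>2 / (H x)\<^sup>2)),
             bloch_jump X \<xi> (lin_flux2 F Hs H (h z) (q z))]] :: complex^2^2)"

definition unstable_spectrum ::
    "real \<Rightarrow> real \<Rightarrow> real \<Rightarrow> (real \<Rightarrow> real) \<Rightarrow>
     (complex \<Rightarrow> real \<Rightarrow> complex) \<Rightarrow> (complex \<Rightarrow> real \<Rightarrow> complex) \<Rightarrow> complex set"
  where "unstable_spectrum F Hs X H h q =
    {z. Re z > 0 \<and> (\<exists>\<xi>\<in>{- pi / X .. pi / X}. evans_lopatinsky F Hs X H h q z \<xi> = 0)}"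


section \<open>The stability index\<close>

text \<open>Derivatives in \<open>x\<close> are taken within the closed cell, hence are one-sided at its ends.\<close>

definition dpressure :: "real \<Rightarrow> real \<Rightarrow> real"  \<comment> \<open>\<open>p'\<close>\<close>
  where "dpressure F a = a / F\<^sup>2"

definition sonic_fn :: "real \<Rightarrow> real \<Rightarrow> (real \<Rightarrow> real) \<Rightarrow> real \<Rightarrow> real"  \<comment> \<open>\<open>m\<close>\<close>
  where "sonic_fn F Hs H x = dpressure F (H x) - (wave_flux F Hs)\<^sup>2 / (H x)\<^sup>2"

definition source :: "real \<Rightarrow> real \<Rightarrow> real"  \<comment> \<open>\<open>r\<close>\<close>
  where "source a b = a - b\<^sup>2 / a\<^sup>2"

definition B1 :: "real \<Rightarrow> real \<Rightarrow> real \<Rightarrow> (real \<Rightarrow> real) \<Rightarrow> real \<Rightarrow> real^2^2"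
  where "B1 F Hs X H x =
    (let r_h = deriv (\<lambda>a. source a (discharge F Hs H x)) (H x);
         r_q = deriv (\<lambda>b. source (H x) b) (discharge F Hs H x)
     in vector
       [vector [0, 0],
        vector [- r_q - vector_derivative (\<lambda>y. 2 * wave_flux F Hs / H y) (at x within {0..X}),
                - vector_derivative (sonic_fn F Hs H) (at x within {0..X})
                  + r_h + wave_speed F Hs * r_q]])"

definition P0 :: "real \<Rightarrow> real \<Rightarrow> (real \<Rightarrow> real) \<Rightarrow> real \<Rightarrow> real^2^2"
  where "P0 F Hs H x = vector
    [vector [wave_flux F Hs / H x + sqrt (dpressure F (H x)),
             wave_flux F Hs / H x - sqrt (dpressure F (H x))],
     vector [1, 1]]"

definition C0 :: "real \<Rightarrow> real \<Rightarrow> real \<Rightarrow> (real \<Rightarrow> real) \<Rightarrow> real \<Rightarrow> real^2^2"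
  where "C0 F Hs X H x =
    matrix_inv (P0 F Hs H x) ** B1 F Hs X H x ** P0 F Hs H x
    - sonic_fn F Hs H x *\<^sub>R
      (matrix_inv (P0 F Hs H x) ** vector_derivative (P0 F Hs H) (at x within {0..X}))"

definition smooth_on :: "(real \<Rightarrow> real) \<Rightarrow> real set \<Rightarrow> bool"
  where "smooth_on f S \<longleftrightarrow>
    (\<exists>D. D 0 = f \<and>
      (\<forall>n. \<forall>x\<in>S. (D n has_real_derivative D (Suc n) x) (at x within S)))"

text \<open>As the function \<open>m\<close> vanishes only at the sonic point, smoothness determines \<open>\<gamma>\<close> on \<open>{0..X}\<close>.\<close>

definition is_gamma_plus ::
    "real \<Rightarrow> real \<Rightarrow> real \<Rightarrow> (real \<Rightarrow> real) \<Rightarrow> (real \<Rightarrow> real) \<Rightarrow> bool"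
  where "is_gamma_plus F Hs X H \<gamma> \<longleftrightarrow>
    smooth_on \<gamma> {0..X} \<and>
    (\<forall>x\<in>{0..X}. C0 F Hs X H x $ 1 $ 1 = sonic_fn F Hs H x * \<gamma> x)"

definition stability_index ::
    "real \<Rightarrow> real \<Rightarrow> real \<Rightarrow> real \<Rightarrow> real \<Rightarrow> (real \<Rightarrow> real) \<Rightarrow> real"
  where "stability_index F Hs Hm Hp X \<gamma> =
    ((sqrt Hm / F + wave_flux F Hs / Hm) / (sqrt Hp / F + wave_flux F Hs / Hp))\<^sup>2
    * exp (- integral {0..X} \<gamma>)"

end

(* Write v = c h - q. Diagonalizing the principal part in the unknowns (v, h) gives a mode y1 that
   crosses the whole cell and a mode y2 whose speed m vanishes at the sonic point. The zeroth-order
   coefficient of the y2 equation vanishes there as well, so y2 = (beta / lambda) y1 + m w for a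
   suitable beta, and w is damped at the sonic point at the rate Re lambda + m'(x_s) > 0. A maximum
   principle then yields w = O(1 / lambda) y1 uniformly on Re lambda >= 0, hence y1 is asymptotic to
   exp (lambda A + G) up to a relative error O(1 / lambda).

   After a row operation, Delta (lambda, xi) = 0 says E (X) = exp (i xi X) E (0) for one scalar
   quantity E. Thus, with T = integral of 1 / fast, lambda is an eigenvalue for some xi iff
   1 = |E (0) / E (X)| = I exp (- T Re lambda) (1 + O(1 / lambda)). This bounds Re lambda, bounds
   lambda if I < 1, and if I > 1 its solutions include a curve asymptotic to Re lambda = ln I / T. *)

theory Submission
  imports Defs "HOL-Complex_Analysis.Complex_Analysis"
begin

section \<open>The system near the sonic point\<close>

text \<open>The obstacle is uniformity up to Re lambda = 0. For large imaginary lambda the term -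
  lambda makes the slow mode oscillate but does not damp it, and its speed vanishes inside the cell.
  Dividing the remainder by \<open>m\<close> turns the derivative of \<open>m\<close> into a damping
  that survives on the imaginary axis. This division requires the forcing of the remainder to
  contain \<open>m\<close> too. Two facts make that possible: beta cancels the forcing of order
  lambda^0 on the whole cell, and the zeroth-order coefficient of the slow mode is divisible by
  \<open>m\<close>. The divisibility reflects the derivative of the profile equation m H' = r(H, Q)
  at the sonic height; the sign m'(x_s) > 0 comes from F > 2.

  Only |E (0) / E (X)| matters because exp (i xi X) runs over the whole unit circle. In E the fast
  mode carries the factor \<open>fast\<close>^2, whence the square in I, while the slow mode is of
  relative order 1 / lambda. The exponent in I appears because the zeroth-order coefficient of y1 is
  the (1,1) entry of \<open>C0\<close> divided by m.\<close>

lemma continuous_on_quotient_simple_zero: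
  fixes f :: "real \<Rightarrow> 'a::real_normed_vector" and m :: "real \<Rightarrow> real"
  assumes "continuous_on S f" "continuous_on S m" "x0 \<in> S" "f x0 = 0" "m x0 = 0"
    and nz: "\<And>x. x \<in> S \<Longrightarrow> x \<noteq> x0 \<Longrightarrow> m x \<noteq> 0"
    and df: "(f has_vector_derivative f') (at x0 within S)"
    and dm: "(m has_real_derivative m') (at x0 within S)" and "m' \<noteq> 0"
  shows "continuous_on S (\<lambda>x. if x = x0 then f' /\<^sub>R m' else f x /\<^sub>R m x)"
proof -
  have "continuous (at x within S) (\<lambda>x. if x = x0 then f' /\<^sub>R m' else f x /\<^sub>R m x)" if "x \<in> S" for x
  proof (cases "x = x0")
    case True
    have "((\<lambda>y. norm ((f y - f x0 - (y - x0) *\<^sub>R f') /\<^sub>R norm (y - x0))) \<longlongrightarrow> 0) (at x0 within S)"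
      using df unfolding has_vector_derivative_def has_derivative_within
      by (intro tendsto_norm_zero) (simp add: diff_diff_eq divide_inverse)
    moreover have "\<forall>\<^sub>F y in at x0 within S. norm ((f y - f x0 - (y - x0) *\<^sub>R f') /\<^sub>R norm (y - x0))
        = norm ((f y - f x0) /\<^sub>R (y - x0) - f')"
    proof -
      have "norm ((f y - f x0 - (y - x0) *\<^sub>R f') /\<^sub>R norm (y - x0)) = norm ((f y - f x0) /\<^sub>R (y - x0) - f')"
        if "y \<noteq> x0" for y
      proof -
        have "(f y - f x0) /\<^sub>R (y - x0) - f' = (f y - f x0 - (y - x0) *\<^sub>R f') /\<^sub>R (y - x0)"
          using that by (simp add: scaleR_diff_right)
        then show ?thesis by simp
      qed
      then show ?thesis by (auto simp: eventually_at_filter)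
    qed
    ultimately have "((\<lambda>y. norm ((f y - f x0) /\<^sub>R (y - x0) - f')) \<longlongrightarrow> 0) (at x0 within S)"
      by (rule Lim_transform_eventually)
    then have 1: "((\<lambda>y. (f y - f x0) /\<^sub>R (y - x0)) \<longlongrightarrow> f') (at x0 within S)"
      by (simp add: tendsto_norm_zero_iff LIM_zero_iff)
    have 2: "((\<lambda>y. (m y - m x0) / (y - x0)) \<longlongrightarrow> m') (at x0 within S)"
      using dm by (simp add: has_field_derivative_iff)
    \<comment> \<open>L'Hopital's rule: since \<open>f\<close> and \<open>m\<close> both vanish at
      \<open>x0\<close>, their quotient is the quotient of their difference quotients.\<close>
    have "((\<lambda>y. inverse ((m y - m x0) / (y - x0)) *\<^sub>R ((f y - f x0) /\<^sub>R (y - x0))) \<longlongrightarrow> inverse m' *\<^sub>R f')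
      (at x0 within S)"
      by (intro tendsto_intros 1 2 assms)
    moreover have "\<forall>\<^sub>F y in at x0 within S. inverse ((m y - m x0) / (y - x0)) *\<^sub>R ((f y - f x0) /\<^sub>R (y - x0))
        = (if y = x0 then f' /\<^sub>R m' else f y /\<^sub>R m y)"
      unfolding eventually_at_filter using assms by (auto intro!: always_eventually simp: field_simps)
    ultimately have "((\<lambda>y. if y = x0 then f' /\<^sub>R m' else f y /\<^sub>R m y) \<longlongrightarrow> f' /\<^sub>R m') (at x0 within S)"
      by (rule Lim_transform_eventually)
    then show ?thesis using True by (simp add: continuous_within)
  next
    case False
    have "continuous (at x within S) (\<lambda>x. f x /\<^sub>R m x)"
      using assms(1,2) nz[OF that False] that
      by (intro continuous_intros) (auto simp: continuous_on_eq_continuous_within)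
    then have "((\<lambda>x. f x /\<^sub>R m x) \<longlongrightarrow> f x /\<^sub>R m x) (at x within S)"
      by (simp add: continuous_within)
    moreover have "\<forall>\<^sub>F y in at x within S. f y /\<^sub>R m y = (if y = x0 then f' /\<^sub>R m' else f y /\<^sub>R m y)"
      using False eventually_at_topological[of _ x S] 
      by (auto intro!: exI[of _ "- {x0}"])
    ultimately have "((\<lambda>y. if y = x0 then f' /\<^sub>R m' else f y /\<^sub>R m y) \<longlongrightarrow> f x /\<^sub>R m x) (at x within S)"
      by (rule Lim_transform_eventually)
    then show ?thesis using False by (simp add: continuous_within)
  qed
  then show ?thesis by (simp add: continuous_on_eq_continuous_within)
qed

text \<open>A maximum of \<open>N\<close> away from \<open>x0\<close>, taken over the segment from \<open>x0\<close>, would have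
  \<open>m x * N' x \<ge> 0\<close>, because \<open>m\<close> has the sign of \<open>x - x0\<close>.\<close>

lemma sonic_maximum_principle:
  fixes N N' m :: "real \<Rightarrow> real"
  assumes "0 < x0" "x0 < X" and cont: "continuous_on {0..X} N"
    and der: "\<And>x. 0 < x \<Longrightarrow> x < X \<Longrightarrow> x \<noteq> x0 \<Longrightarrow> (N has_real_derivative N' x) (at x)"
    and neg: "\<And>x. 0 < x \<Longrightarrow> x < x0 \<Longrightarrow> m x < 0"
    and pos: "\<And>x. x0 < x \<Longrightarrow> x < X \<Longrightarrow> m x > 0"
    and le: "\<And>x. 0 < x \<Longrightarrow> x < X \<Longrightarrow> x \<noteq> x0 \<Longrightarrow> N x > L \<Longrightarrow> m x * N' x < 0"
    and at: "N x0 \<le> L" and x: "x \<in> {0..X}"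
  shows "N x \<le> L"
proof -
  have int: "N y \<le> L" if y: "0 < y" "y < X" for y
  proof (rule ccontr)
    assume "\<not> N y \<le> L"
    then have y1: "N y > L" by simp
    with at have "y \<noteq> x0" by auto
    then consider "y > x0" | "y < x0" by linarith
    then show False
    proof cases
      case 1
      have "continuous_on {x0..y} N" by (rule continuous_on_subset[OF cont]) (use assms y in auto)
      then obtain u where u: "u \<in> {x0..y}" "\<And>v. v \<in> {x0..y} \<Longrightarrow> N v \<le> N u"
        using continuous_attains_sup[of "{x0..y}" N] 1 by auto
      have nu: "N u > L" using u(2)[of y] 1 y1 by auto
      then have "u > x0" using u(1) at by (cases "u = x0") auto
      have uX: "0 < u" "u < X" "u \<noteq> x0" using u y \<open>u > x0\<close> assms by auto
      have "N' u < 0" using le[OF uX nu] pos[of u] \<open>u > x0\<close> uX by (simp add: mult_less_0_iff) 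
      \<comment> \<open>The maximizer \<open>u\<close> may be the end \<open>y\<close> of the
        segment, so the contradiction has to come from a step towards \<open>x0\<close>.\<close>
      then obtain d where d: "d > 0" "\<And>h. h > 0 \<Longrightarrow> h < d \<Longrightarrow> N u < N (u - h)"
        using DERIV_neg_dec_left[OF der[OF uX]] by blast
      define h where "h = min (d/2) (u - x0)"
      have "h > 0" "h < d" "u - h \<in> {x0..y}" using d \<open>u > x0\<close> u by (auto simp: h_def min_def)
      with d u(2) show False by fastforce
    next
      case 2
      have "continuous_on {y..x0} N" by (rule continuous_on_subset[OF cont]) (use assms y in auto)
      then obtain u where u: "u \<in> {y..x0}" "\<And>v. v \<in> {y..x0} \<Longrightarrow> N v \<le> N u"
        using continuous_attains_sup[of "{y..x0}" N] 2 by auto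
      have nu: "N u > L" using u(2)[of y] 2 y1 by auto
      then have "u < x0" using u(1) at by (cases "u = x0") auto
      have uX: "0 < u" "u < X" "u \<noteq> x0" using u y \<open>u < x0\<close> assms by auto
      have "N' u > 0" using le[OF uX nu] neg[of u] \<open>u < x0\<close> uX by (simp add: mult_less_0_iff) 
      then obtain d where d: "d > 0" "\<And>h. h > 0 \<Longrightarrow> h < d \<Longrightarrow> N u < N (u + h)"
        using DERIV_pos_inc_right[OF der[OF uX]] by blast
      define h where "h = min (d/2) (x0 - u)"
      have "h > 0" "h < d" "u + h \<in> {y..x0}" using d \<open>u < x0\<close> u by (auto simp: h_def min_def)
      with d u(2) show False by fastforce
    qed
  qed
  \<comment> \<open>No derivative is available at the ends of the cell; the bound reaches them by
    continuity.\<close>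
  have cl: "closure {0<..<X} = {0..X}" using assms by (simp add: closure_greaterThanLessThan)
  show ?thesis
    by (rule continuous_le_on_closure[of "{0<..<X}" N x L]) (use cl cont x int in auto)
qed

text \<open>The points where \<open>j\<close> is at least half of its negative value at
  \<open>x0\<close> form a compact set avoiding \<open>x0\<close>, so \<open>n\<close> has a
  positive lower bound there and a large \<open>K\<close> wins; elsewhere \<open>j\<close> is
  negative enough by itself. The resulting \<open>K\<close> is the exponent of the weight that
  extends the damping at the sonic point to the whole cell.\<close>

lemma exists_multiple_dominating:
  fixes j n :: "real \<Rightarrow> real"
  assumes "compact S" "continuous_on S j" "continuous_on S n" "x0 \<in> S" "j x0 < 0"
    and nn: "\<And>x. x \<in> S \<Longrightarrow> n x \<ge> 0" and pos: "\<And>x. x \<in> S \<Longrightarrow> x \<noteq> x0 \<Longrightarrow> n x > 0"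
  obtains K \<kappa> where "K \<ge> 0" "\<kappa> > 0" "\<And>x. x \<in> S \<Longrightarrow> j x - K * n x \<le> - \<kappa>"
proof -
  define C where "C = {x \<in> S. j x \<ge> j x0 / 2}"
  have "C = S \<inter> j -` {j x0 / 2 ..}" by (auto simp: C_def)
  then have "compact C"
    by (metis assms(1,2) closed_atLeast compact_Int_closed compact_imp_closed continuous_closed_preimage
        inf.absorb_iff2 inf_le1)
  have nC: "n x > 0" if "x \<in> C" for x using that pos[of x] assms(5) by (cases "x = x0") (auto simp: C_def)
  have CS: "C \<subseteq> S" by (auto simp: C_def)
  obtain n0 where n0: "n0 > 0" "\<And>x. x \<in> C \<Longrightarrow> n x \<ge> n0"
  proof (cases "C = {}")
    case False
    then obtain u where "u \<in> C" "\<And>v. v \<in> C \<Longrightarrow> n u \<le> n v"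
      using continuous_attains_inf[OF \<open>compact C\<close>] continuous_on_subset[OF assms(3) CS] by blast
    then show ?thesis using that nC by blast
  qed (use that[of 1] in auto)
  obtain J where J: "J > 0" "\<And>x. x \<in> S \<Longrightarrow> \<bar>j x\<bar> \<le> J"
    using compact_imp_bounded[OF compact_continuous_image[OF assms(2,1)]] unfolding bounded_pos by auto
  define K where "K = (J - j x0) / n0"
  have K: "K \<ge> 0" using J n0 assms(5) by (auto simp: K_def)
  have "j x - K * n x \<le> - (- j x0 / 2)" if x: "x \<in> S" for x
  proof (cases "x \<in> C")
    case True
    have "K * n x \<ge> K * n0" using n0 True K by (simp add: mult_left_mono)
    also have "K * n0 = J - j x0" using n0 by (simp add: K_def)
    finally show ?thesis using J(2)[OF x] assms(5) by linarith
  next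
    case False
    have "K * n x \<ge> 0" using nn[OF x] K by simp
    then show ?thesis using False x by (auto simp: C_def)
  qed
  then show thesis using that[of K "- j x0 / 2"] K assms(5) by auto
qed

text \<open>Of the damping 2 \<open>\<kappa>\<close>, one half absorbs \<open>e\<close> and the
  other competes with the forcing \<open>f * z\<close>, so the maximum principle bounds |U| by max
  |z| / |l| up to a constant. Then z' is of the same size, and for large |l| the variation of
  \<open>z\<close> is too small for max |z| to exceed twice its value at \<open>x0\<close>. The term
  with \<open>\<omega>\<close> only has to have the right sign, so no lower bound on Re l beyond 0
  enters.\<close>

lemma damped_system_estimate:
  fixes z U z' U' :: "real \<Rightarrow> complex" and m \<omega> D :: "real \<Rightarrow> real" and p r e f :: "real \<Rightarrow> complex"
    and l :: complex
  assumes x0: "0 < x0" "x0 < X" and contz: "continuous_on {0..X} z" and contU: "continuous_on {0..X} U"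
    and dz: "\<And>x. 0 < x \<Longrightarrow> x < X \<Longrightarrow> (z has_vector_derivative (p x * z x + r x * U x)) (at x)"
    and dU: "\<And>x. 0 < x \<Longrightarrow> x < X \<Longrightarrow> x \<noteq> x0 \<Longrightarrow> (U has_vector_derivative U' x) (at x)"
    and eU: "\<And>x. 0 < x \<Longrightarrow> x < X \<Longrightarrow> x \<noteq> x0 \<Longrightarrow>
      of_real (m x) * U' x = (- l * of_real (\<omega> x) + of_real (D x) + e x) * U x + f x * z x"
    and e0: "0 = (- l * of_real (\<omega> x0) + of_real (D x0) + e x0) * U x0 + f x0 * z x0"
    and neg: "\<And>x. 0 < x \<Longrightarrow> x < x0 \<Longrightarrow> m x < 0" and pos: "\<And>x. x0 < x \<Longrightarrow> x < X \<Longrightarrow> m x > 0"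
    and \<omega>: "\<And>x. x \<in> {0..X} \<Longrightarrow> \<omega> x \<ge> 0" and D: "\<And>x. x \<in> {0..X} \<Longrightarrow> D x \<le> - (2 * \<kappa>)"
    and \<kappa>: "\<kappa> > 0" and M: "M > 0"
    and bd: "\<And>x. x \<in> {0..X} \<Longrightarrow> cmod (p x) \<le> M / cmod l" "\<And>x. x \<in> {0..X} \<Longrightarrow> cmod (r x) \<le> M"
      "\<And>x. x \<in> {0..X} \<Longrightarrow> cmod (e x) \<le> M / cmod l" "\<And>x. x \<in> {0..X} \<Longrightarrow> cmod (f x) \<le> M / cmod l"
    and l: "Re l \<ge> 0" "cmod l \<ge> M / \<kappa>" "cmod l \<ge> 2 * X * (M + M * M / \<kappa>)"
    and x: "x \<in> {0..X}"
  shows "cmod (z x - z x0) \<le> 2 * X * (M + M * M / \<kappa>) / cmod l * cmod (z x0)"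
    and "cmod (U x) \<le> 2 * M / \<kappa> / cmod l * cmod (z x0)"
proof -
  have lp: "cmod l > 0" using l(2) \<kappa> M by (meson divide_pos_pos less_le_trans)
  have X: "X > 0" using x0 by simp
  obtain u where u: "u \<in> {0..X}" "\<And>v. v \<in> {0..X} \<Longrightarrow> cmod (z v) \<le> cmod (z u)"
    using continuous_attains_sup[of "{0..X}" "\<lambda>v. cmod (z v)"] continuous_on_norm[OF contz] X
    by fastforce
  define m0 where "m0 = cmod (z u)"
  have m0: "m0 \<ge> 0" "\<And>v. v \<in> {0..X} \<Longrightarrow> cmod (z v) \<le> m0" using u by (auto simp: m0_def)
  have Mk: "M / cmod l \<le> \<kappa>" using l(2) lp \<kappa> by (simp add: field_simps)
  define N where "N = (\<lambda>x. U x \<bullet> U x)"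
  \<comment> \<open>The value of |U| at which the damping \<open>\<kappa>\<close> |U|^2 balances the
    largest possible forcing.\<close>
  define B where "B = M / cmod l * m0 / \<kappa>"
  have B: "B \<ge> 0" using M m0 \<kappa> by (auto simp: B_def)
  have key: "U y \<bullet> ((- l * of_real (\<omega> y) + of_real (D y) + e y) * U y + f y * z y)
       \<le> - \<kappa> * (cmod (U y))\<^sup>2 + \<kappa> * B * cmod (U y)" if y: "y \<in> {0..X}" for y
  proof -
    have "U y \<bullet> ((- l * of_real (\<omega> y) + of_real (D y) + e y) * U y + f y * z y)
       = (- Re l * \<omega> y + D y) * (cmod (U y))\<^sup>2 + U y \<bullet> (e y * U y) + U y \<bullet> (f y * z y)"
      unfolding cmod_power2 by (simp add: inner_complex_def algebra_simps power2_eq_square)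
    moreover have "U y \<bullet> (e y * U y) \<le> \<kappa> * (cmod (U y))\<^sup>2"
    proof -
      have "U y \<bullet> (e y * U y) \<le> cmod (U y) * (cmod (e y) * cmod (U y))"
        using norm_cauchy_schwarz[of "U y" "e y * U y"] by (simp add: norm_mult)
      also have "\<dots> = cmod (e y) * (cmod (U y))\<^sup>2" by (simp add: power2_eq_square)
      also have "\<dots> \<le> \<kappa> * (cmod (U y))\<^sup>2" using bd(3)[OF y] Mk by (intro mult_right_mono) auto
      finally show ?thesis .
    qed
    moreover have "U y \<bullet> (f y * z y) \<le> \<kappa> * B * cmod (U y)"
    proof -
      have "U y \<bullet> (f y * z y) \<le> cmod (U y) * (cmod (f y) * cmod (z y))"
        using norm_cauchy_schwarz[of "U y" "f y * z y"] by (simp add: norm_mult)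
      also have "\<dots> \<le> cmod (U y) * (M / cmod l * m0)"
        using bd(4)[OF y] m0(2)[OF y] lp M by (intro mult_left_mono mult_mono) auto
      finally show ?thesis using \<kappa> by (simp add: B_def mult_ac)
    qed
    moreover have "(- Re l * \<omega> y + D y) * (cmod (U y))\<^sup>2 \<le> - (2 * \<kappa>) * (cmod (U y))\<^sup>2"
      using \<omega>[OF y] D[OF y] l(1) by (intro mult_right_mono) (auto intro: order_trans[of _ "D y"])
    ultimately show ?thesis by (simp add: algebra_simps)
  qed
  have NB: "N y \<le> B\<^sup>2" if y: "y \<in> {0..X}" for y
  proof (rule sonic_maximum_principle[where N = N and x = y and L = "B\<^sup>2" and N' = "\<lambda>x. 2 * (U x \<bullet> U' x)" and m = m, OF x0])
    show "continuous_on {0..X} N" unfolding N_def by (intro continuous_intros contU)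
    show "(N has_real_derivative 2 * (U v \<bullet> U' v)) (at v)" if "0 < v" "v < X" "v \<noteq> x0" for v
      unfolding N_def has_real_derivative_iff_has_vector_derivative
      using bounded_bilinear.has_vector_derivative[OF bounded_bilinear_inner dU[OF that] dU[OF that]]
      by (simp add: inner_commute)
    show "m v < 0" if "0 < v" "v < x0" for v using neg that by auto
    show "m v > 0" if "x0 < v" "v < X" for v using pos that by auto
    show "m v * (2 * (U v \<bullet> U' v)) < 0" if v: "0 < v" "v < X" "v \<noteq> x0" and nv: "N v > B\<^sup>2" for v
    proof -
      have gt: "cmod (U v) > B" using nv B by (simp add: N_def power2_norm_eq_inner[symmetric] power2_less_imp_less)
      have "m v * (U v \<bullet> U' v) = U v \<bullet> (of_real (m v) * U' v)"
        by (simp add: inner_complex_def algebra_simps)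
      also have "\<dots> \<le> - \<kappa> * (cmod (U v))\<^sup>2 + \<kappa> * B * cmod (U v)"
        unfolding eU[OF v] using v by (intro key) auto
      also have "\<dots> = - (\<kappa> * cmod (U v) * (cmod (U v) - B))" by (simp add: algebra_simps power2_eq_square)
      also have "\<dots> < 0" using \<kappa> gt B by (smt (verit) mult_pos_pos)
      finally show ?thesis by simp
    qed
    \<comment> \<open>At \<open>x0\<close> the equation has no derivative term, so the energy
      inequality bounds \<open>U x0\<close> directly and provides the starting value for the maximum
      principle.\<close>
    show "N x0 \<le> B\<^sup>2"
    proof (rule ccontr)
      assume "\<not> N x0 \<le> B\<^sup>2"
      then have gt: "cmod (U x0) > B" using B by (simp add: N_def power2_norm_eq_inner[symmetric] power2_less_imp_less)
      have "0 \<le> - \<kappa> * (cmod (U x0))\<^sup>2 + \<kappa> * B * cmod (U x0)"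
        using key[of x0] x0 unfolding e0[symmetric] by simp
      also have "\<dots> = - (\<kappa> * cmod (U x0) * (cmod (U x0) - B))" by (simp add: algebra_simps power2_eq_square)
      also have "\<dots> < 0" using \<kappa> gt B by (smt (verit) mult_pos_pos)
      finally show False by simp
    qed
    show "y \<in> {0..X}" by fact
  qed
  have UB: "cmod (U y) \<le> B" if "y \<in> {0..X}" for y
    using NB[OF that] B by (simp add: N_def power2_norm_eq_inner[symmetric] abs_le_square_iff[symmetric])
  define L where "L = (M + M * M / \<kappa>) / cmod l * m0"
  have L0: "L \<ge> 0" using M \<kappa> m0 by (auto simp: L_def)
  have zd: "cmod (p y * z y + r y * U y) \<le> L" if y: "y \<in> {0..X}" for y
  proof -
    have "cmod (p y * z y + r y * U y) \<le> cmod (p y) * cmod (z y) + cmod (r y) * cmod (U y)"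
      by (metis norm_mult norm_triangle_ineq)
    also have "\<dots> \<le> M / cmod l * m0 + M * B"
      using bd[OF y] m0(2)[OF y] UB[OF y] M by (intro add_mono mult_mono) auto
    also have "\<dots> = L" using lp \<kappa> by (simp add: L_def B_def field_simps)
    finally show ?thesis .
  qed
  have diff: "cmod (z y - z x0) \<le> X * L" if y: "y \<in> {0..X}" for y
  proof (cases "y = x0")
    case True then show ?thesis using X L0 by simp
  next
    case False
    have *: "norm (z b - z a) \<le> L * (b - a)" if ab: "0 \<le> a" "a < b" "b \<le> X" for a b
    proof -
      have "norm (z b - z a) \<le> L * b - L * a"
        by (rule differentiable_bound_general[of a b z "\<lambda>x. L * x" "\<lambda>y. p y * z y + r y * U y" "\<lambda>_. L"])
          (use ab zd dz continuous_on_subset[OF contz] in \<open>auto intro!: continuous_intros derivative_eq_intros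
             simp: has_real_derivative_iff_has_vector_derivative[symmetric]\<close>)
      then show ?thesis by (simp add: algebra_simps)
    qed
    have "norm (z y - z x0) \<le> L * \<bar>y - x0\<bar>"
      using *[of x0 y] *[of y x0] False y x0 by (cases "x0 < y") (auto simp: norm_minus_commute)
    also have "\<dots> \<le> L * X" using y x0 L0 by (intro mult_left_mono) auto
    finally show ?thesis by (simp add: mult.commute)
  qed
  \<comment> \<open>The loop closes here: the variation of \<open>z\<close> is at most half of its
    maximum \<open>m0\<close>, hence \<open>m0\<close> is at most twice |z x0|.\<close>
  have "X * L = X * (M + M * M / \<kappa>) / cmod l * m0" by (simp add: L_def)
  also have "X * (M + M * M / \<kappa>) / cmod l \<le> 1 / 2" using l(3) lp by (simp add: field_simps)
  finally have "X * L \<le> m0 / 2" using m0 by (simp add: mult_right_mono)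
  moreover have "m0 \<le> cmod (z x0) + cmod (z u - z x0)" unfolding m0_def
    by (metis norm_triangle_sub)
  ultimately have m2: "m0 \<le> 2 * cmod (z x0)" using diff[OF u(1)] by linarith
  have "X * L \<le> X * ((M + M * M / \<kappa>) / cmod l * (2 * cmod (z x0)))"
    unfolding L_def using m2 X M \<kappa> by (intro mult_left_mono) auto
  then show "cmod (z x - z x0) \<le> 2 * X * (M + M * M / \<kappa>) / cmod l * cmod (z x0)"
    by (intro order_trans[OF diff[OF x]]) (simp add: algebra_simps)
  have "B \<le> M / cmod l * (2 * cmod (z x0)) / \<kappa>"
    unfolding B_def using m2 M \<kappa> by (intro divide_right_mono mult_left_mono) auto
  then show "cmod (U x) \<le> 2 * M / \<kappa> / cmod l * cmod (z x0)"
    using UB[OF x] by (simp add: mult_ac)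
qed

lemma continuous_on_Icc_bounded:
  fixes f :: "real \<Rightarrow> real"
  assumes "continuous_on {a..b} f"
  shows "\<exists>B>0. \<forall>x\<in>{a..b}. \<bar>f x\<bar> \<le> B"
  using compact_imp_bounded[OF compact_continuous_image[OF assms compact_Icc]]
  unfolding bounded_pos by auto

text \<open>A diagonalized eigenvalue system: \<open>y1\<close> belongs to the mode which crosses the cell and \<open>y2\<close> to the
  mode whose speed \<open>m\<close> vanishes at \<open>x0\<close>.\<close>

definition sonic_system_solution ::
    "real \<Rightarrow> real \<Rightarrow> (real \<Rightarrow> real) \<Rightarrow> (real \<Rightarrow> real) \<Rightarrow> (real \<Rightarrow> real) \<Rightarrow> (real \<Rightarrow> real) \<Rightarrow> (real \<Rightarrow> real) \<Rightarrow>
     (real \<Rightarrow> real) \<Rightarrow> complex \<Rightarrow> (real \<Rightarrow> complex) \<Rightarrow> (real \<Rightarrow> complex) \<Rightarrow> bool"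
  where "sonic_system_solution X x0 a m \<gamma> \<delta> b d l y1 y2 \<longleftrightarrow>
    continuous_on {0..X} y1 \<and> continuous_on {0..X} y2 \<and>
    (\<exists>y2'. isCont y2' x0 \<and> (\<forall>x\<in>{0<..<X}.
      (y1 has_vector_derivative
        (l / of_real (a x) + of_real (\<gamma> x)) * y1 x + of_real (\<delta> x) * y2 x) (at x) \<and>
      (y2 has_vector_derivative y2' x) (at x) \<and>
      of_real (m x) * y2' x = (- l + of_real (d x)) * y2 x + of_real (b x) * y1 x))"

definition damping :: "(real \<Rightarrow> real) \<Rightarrow> (real \<Rightarrow> real) \<Rightarrow> complex \<Rightarrow> real \<Rightarrow> complex"
  where "damping A G l x = exp (- (l * of_real (A x) + of_real (G x)))"

text \<open>The coefficient of \<open>y2\<close> is passed as \<open>m x * d x\<close> so that the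
  remainder \<open>Y\<close> of the proof is forced by a multiple of \<open>m\<close> and can be
  divided by it. \<open>C\<close> and \<open>R\<close> are fixed before \<open>l\<close>, which
  makes the estimate uniform on the closed half plane; positivity of \<open>a + m\<close> gives the
  large term - l \<open>\<omega>\<close> a nonpositive real part there.\<close>

lemma sonic_system_asymptotics:
  fixes a m m' \<gamma> \<delta> b d \<beta> \<beta>' A G :: "real \<Rightarrow> real" and x0 X :: real
  assumes x0: "0 < x0" "x0 < X"
    and dm: "\<And>x. x \<in> {0..X} \<Longrightarrow> (m has_real_derivative m' x) (at x within {0..X})"
    and cm': "continuous_on {0..X} m'"
    and m0: "m x0 = 0" "m' x0 > 0"
    and neg: "\<And>x. x \<in> {0..X} \<Longrightarrow> x < x0 \<Longrightarrow> m x < 0" and pos: "\<And>x. x \<in> {0..X} \<Longrightarrow> x0 < x \<Longrightarrow> m x > 0"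
    and ca: "continuous_on {0..X} a" and a: "\<And>x. x \<in> {0..X} \<Longrightarrow> a x > 0"
    and am: "\<And>x. x \<in> {0..X} \<Longrightarrow> a x + m x > 0"
    and cc: "continuous_on {0..X} \<gamma>" "continuous_on {0..X} \<delta>" "continuous_on {0..X} d"
    and d\<beta>: "\<And>x. x \<in> {0..X} \<Longrightarrow> (\<beta> has_real_derivative \<beta>' x) (at x within {0..X})"
    and c\<beta>': "continuous_on {0..X} \<beta>'"
    and \<beta>: "\<And>x. x \<in> {0..X} \<Longrightarrow> \<beta> x = a x * b x / (a x + m x)"
    and dA: "\<And>x. x \<in> {0..X} \<Longrightarrow> (A has_real_derivative 1 / a x) (at x within {0..X})"
    and dG: "\<And>x. x \<in> {0..X} \<Longrightarrow> (G has_real_derivative \<gamma> x) (at x within {0..X})"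
  obtains C R where "C > 0" "R > 0"
    "\<And>l y1 y2 x. Re l \<ge> 0 \<Longrightarrow> cmod l \<ge> R \<Longrightarrow>
      sonic_system_solution X x0 a m \<gamma> \<delta> b (\<lambda>x. m x * d x) l y1 y2 \<Longrightarrow> x \<in> {0..X} \<Longrightarrow>
      cmod (damping A G l x * y1 x - damping A G l x0 * y1 x0)
        \<le> C / cmod l * cmod (damping A G l x0 * y1 x0) \<and>
      cmod (damping A G l x * y2 x) \<le> C / cmod l * cmod (damping A G l x0 * y1 x0)"
proof -
  have X: "X > 0" and x0S: "x0 \<in> {0..X}" using x0 by auto
  have cm: "continuous_on {0..X} m" using dm DERIV_continuous_on by blast
  have c\<beta>: "continuous_on {0..X} \<beta>" using d\<beta> DERIV_continuous_on by blast
  note ci = continuous_intros cm cm' ca cc c\<beta> c\<beta>'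
  obtain K \<kappa>2 where K: "K \<ge> 0" "\<kappa>2 > 0" and K2:
    "\<And>x. x \<in> {0..X} \<Longrightarrow> (m x * (d x - \<gamma> x) - m' x) - K * (m x * (x - x0)) \<le> - \<kappa>2"
  proof (rule exists_multiple_dominating[of "{0..X}" "\<lambda>x. m x * (d x - \<gamma> x) - m' x" "\<lambda>x. m x * (x - x0)" x0])
    show "continuous_on {0..X} (\<lambda>x. m x * (d x - \<gamma> x) - m' x)" by (intro ci)
    show "continuous_on {0..X} (\<lambda>x. m x * (x - x0))" by (intro ci)
    show "m x * (x - x0) > 0" if "x \<in> {0..X}" "x \<noteq> x0" for x
      using neg[of x] pos[of x] that by (cases "x < x0") (auto simp: mult_neg_neg)
    then show "m x * (x - x0) \<ge> 0" if "x \<in> {0..X}" for x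
      using that by (cases "x = x0") (auto intro: less_imp_le)
  qed (use m0 x0S in auto)
  define \<kappa> where "\<kappa> = \<kappa>2 / 2"
  have \<kappa>: "\<kappa> > 0" using K by (simp add: \<kappa>_def)
  \<comment> \<open>The logarithmic derivative - K (x - x0) of this weight, multiplied by
    \<open>m\<close>, is nonpositive. It vanishes at the sonic point, where m' already damps, and
    supplies the missing damping elsewhere.\<close>
  define th where "th = (\<lambda>x. exp (- K * (x - x0)\<^sup>2 / 2))"
  have th: "th x > 0" "th x \<le> 1" for x using K by (auto simp: th_def)
  have th0: "th x0 = 1" by (simp add: th_def)
  have cth: "continuous_on {0..X} th" unfolding th_def by (intro continuous_intros) auto
  have "continuous_on {0..X} (\<lambda>x. \<delta> x * \<beta> x)" by (intro ci)
  then obtain M1 where M1: "M1 > 0" "\<And>x. x \<in> {0..X} \<Longrightarrow> \<bar>\<delta> x * \<beta> x\<bar> \<le> M1"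
    using continuous_on_Icc_bounded by blast
  have "continuous_on {0..X} (\<lambda>x. \<delta> x * m x / th x)"
    using th by (intro ci cth) (auto simp: less_imp_neq[symmetric])
  then obtain M2 where M2: "M2 > 0" "\<And>x. x \<in> {0..X} \<Longrightarrow> \<bar>\<delta> x * m x / th x\<bar> \<le> M2"
    using continuous_on_Icc_bounded by blast
  have "continuous_on {0..X} (\<lambda>x. m x * \<beta> x * \<delta> x)" by (intro ci)
  then obtain M3 where M3: "M3 > 0" "\<And>x. x \<in> {0..X} \<Longrightarrow> \<bar>m x * \<beta> x * \<delta> x\<bar> \<le> M3"
    using continuous_on_Icc_bounded by blast
  have "continuous_on {0..X} (\<lambda>x. d x * \<beta> x - \<beta>' x - \<beta> x * \<gamma> x)" by (intro ci)
  then obtain M4 where M4: "M4 > 0" "\<And>x. x \<in> {0..X} \<Longrightarrow> \<bar>d x * \<beta> x - \<beta>' x - \<beta> x * \<gamma> x\<bar> \<le> M4"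
    using continuous_on_Icc_bounded by blast
  have "continuous_on {0..X} (\<lambda>x. (\<beta> x)\<^sup>2 * \<delta> x)" by (intro ci)
  then obtain M5 where M5: "M5 > 0" "\<And>x. x \<in> {0..X} \<Longrightarrow> \<bar>(\<beta> x)\<^sup>2 * \<delta> x\<bar> \<le> M5"
    using continuous_on_Icc_bounded by blast
  have "continuous_on {0..X} (\<lambda>x. m x / th x)"
    using th by (intro ci cth) (auto simp: less_imp_neq[symmetric])
  then obtain M6 where M6: "M6 > 0" "\<And>x. x \<in> {0..X} \<Longrightarrow> \<bar>m x / th x\<bar> \<le> M6"
    using continuous_on_Icc_bounded by blast
  obtain M7 where M7: "M7 > 0" "\<And>x. x \<in> {0..X} \<Longrightarrow> \<bar>\<beta> x\<bar> \<le> M7"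
    using continuous_on_Icc_bounded[OF c\<beta>] by blast
  \<comment> \<open>\<open>M1\<close>, \<open>M2\<close>, \<open>M3\<close> control the coefficients
    \<open>p\<close>, \<open>r\<close>, \<open>e\<close> below, and \<open>M4 + M5\<close> the
    forcing \<open>f\<close>. \<open>M6\<close> and \<open>M7\<close> serve to return from
    \<open>U\<close> to \<open>y2\<close>.\<close>
  define M where "M = M1 + M2 + M3 + M4 + M5"
  have M: "M > 0" using M1 M2 M3 M4 M5 by (simp add: M_def)
  define L where "L = M + M * M / \<kappa>"
  have L: "L > 0" using M \<kappa> by (simp add: L_def add_pos_pos)
  define R where "R = 1 + M / \<kappa> + 2 * X * L"
  define C where "C = 2 * X * L + M6 * (2 * M / \<kappa>) + M7 * (1 + 2 * X * L)"
  show thesis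
  proof (rule that[of C R])
    show "C > 0" "R > 0" unfolding C_def R_def using M \<kappa> X L M6 M7
      by (auto intro!: add_pos_pos add_pos_nonneg)
    fix l y1 y2 x
    assume l: "Re l \<ge> 0" "cmod l \<ge> R" and x: "x \<in> {0..X}"
      and sol: "sonic_system_solution X x0 a m \<gamma> \<delta> b (\<lambda>x. m x * d x) l y1 y2"
    define y1' where "y1' x = (l / of_real (a x) + of_real (\<gamma> x)) * y1 x + of_real (\<delta> x) * y2 x" for x
    have c1: "continuous_on {0..X} y1" and c2: "continuous_on {0..X} y2"
      using sol by (auto simp: sonic_system_solution_def)
    obtain y2' where cy2': "isCont y2' x0"
      and d1: "\<And>x. 0 < x \<Longrightarrow> x < X \<Longrightarrow> (y1 has_vector_derivative y1' x) (at x)"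
      and d2: "\<And>x. 0 < x \<Longrightarrow> x < X \<Longrightarrow> (y2 has_vector_derivative y2' x) (at x)"
      and e2: "\<And>x. 0 < x \<Longrightarrow> x < X \<Longrightarrow> of_real (m x) * y2' x
        = (- l + of_real (m x * d x)) * y2 x + of_real (b x) * y1 x"
      using sol unfolding sonic_system_solution_def y1'_def by auto
    note e1 = y1'_def
    have l1: "cmod l \<ge> 1" "cmod l \<ge> M / \<kappa>" "cmod l \<ge> 2 * X * L"
      using l(2) M \<kappa> X L unfolding R_def by (smt (verit) divide_pos_pos mult_pos_pos)+
    have lp: "cmod l > 0" and ln: "l \<noteq> 0" using l1 by auto
    define P where "P = damping A G l"
    define P' where "P' = (\<lambda>x. - (l / of_real (a x) + of_real (\<gamma> x)) * P x)"
    have cA: "continuous_on {0..X} A" by (rule DERIV_continuous_on[OF dA])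
    have cG: "continuous_on {0..X} G" by (rule DERIV_continuous_on[OF dG])
    have cP: "continuous_on {0..X} P" unfolding P_def damping_def by (intro continuous_intros cA cG)
    have at: "at x within {0..X} = at x" if "0 < x" "x < X" for x
      using that by (simp add: at_within_Icc_at)
    have dP: "(P has_vector_derivative P' x) (at x)" if x: "0 < x" "x < X" for x
    proof -
      have *: "((\<lambda>x. of_real (A x)) has_vector_derivative complex_of_real (1 / a x)) (at x)"
        "((\<lambda>x. of_real (G x)) has_vector_derivative complex_of_real (\<gamma> x)) (at x)"
        using dA[of x] dG[of x] x
        by (simp_all only: at has_real_derivative_iff_has_vector_derivative atLeastAtMost_iff
            less_imp_le has_vector_derivative_of_real)
      have "((\<lambda>x. - (l * of_real (A x) + of_real (G x))) has_vector_derivative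
          - (l * of_real (1 / a x) + of_real (\<gamma> x))) (at x)"
        by (intro derivative_intros *)
      from field_vector_diff_chain_at[OF this DERIV_exp]
      show ?thesis by (simp add: P_def P'_def o_def damping_def[abs_def])
    qed
    \<comment> \<open>After multiplication by \<open>P\<close> the derivative of \<open>z\<close> is
      \<open>\<delta>\<close> P y2, with no term of order \<open>l\<close> left.\<close>
    define z where "z = (\<lambda>x. P x * y1 x)"
    define z' where "z' = (\<lambda>x. P x * y1' x + P' x * y1 x)"
    define Y where "Y = (\<lambda>x. P x * y2 x - of_real (\<beta> x) / l * z x)"
    define Y' where "Y' = (\<lambda>x. (P x * y2' x + P' x * y2 x)
       - (of_real (\<beta> x) / l * z' x + of_real (\<beta>' x) / l * z x))"
    have dz: "(z has_vector_derivative z' x) (at x)" if "0 < x" "x < X" for x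
      unfolding z_def z'_def by (intro has_vector_derivative_mult dP d1 that)
    have cz: "continuous_on {0..X} z" unfolding z_def by (intro continuous_intros cP c1)
    have cY: "continuous_on {0..X} Y" unfolding Y_def by (intro ci cP c2 cz) (simp add: ln)
    have dY: "(Y has_vector_derivative Y' x) (at x)" if x: "0 < x" "x < X" for x
    proof -
      have *: "((\<lambda>x. of_real (\<beta> x)) has_vector_derivative complex_of_real (\<beta>' x)) (at x)"
        using d\<beta>[of x] x by (auto simp: at has_real_derivative_iff_has_vector_derivative
            intro!: has_vector_derivative_of_real)
      have "((\<lambda>x. of_real (\<beta> x) / l) has_vector_derivative complex_of_real (\<beta>' x) / l) (at x)"
        by (intro has_vector_derivative_divide *)
      then show ?thesis unfolding Y_def Y'_def
        by (intro has_vector_derivative_diff has_vector_derivative_mult dP d2 dz x)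
    qed
    define W where "W = (\<lambda>x. if x = x0 then Y' x0 /\<^sub>R m' x0 else Y x /\<^sub>R m x)"
    \<comment> \<open>At the sonic point the second equation is algebraic, l y2 = b y1, and
      \<open>\<beta>\<close> equals \<open>b\<close> there.\<close>
    have Y0: "Y x0 = 0"
    proof -
      have "\<beta> x0 = b x0" using \<beta>[OF x0S] a[OF x0S] m0 by simp
      moreover have "l * y2 x0 = of_real (b x0) * y1 x0"
        using e2[OF x0] m0 by (simp add: algebra_simps add_eq_0_iff2)
      ultimately show ?thesis using ln by (simp add: Y_def z_def field_simps)
    qed
    have mn: "m x \<noteq> 0" if "x \<in> {0..X}" "x \<noteq> x0" for x
      using neg[of x] pos[of x] that by (cases "x < x0") auto
    have cW: "continuous_on {0..X} W" unfolding W_def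
      using mn m0 x0S Y0 dm[OF x0S] dY[OF x0]
      by (intro continuous_on_quotient_simple_zero cY cm) (auto simp: has_vector_derivative_at_within)
    have YW: "Y x = of_real (m x) * W x" if "x \<in> {0..X}" for x
      using mn[OF that] Y0 m0 by (auto simp: W_def scaleR_conv_of_real)
    define \<omega> where "\<omega> = (\<lambda>x. (a x + m x) / a x)"
    define g where "g = (\<lambda>x. (of_real (d x * \<beta> x - \<beta>' x - \<beta> x * \<gamma> x) - of_real ((\<beta> x)\<^sup>2 * \<delta> x) / l) / l)"
    have y2Y: "P x * y2 x = Y x + of_real (\<beta> x) / l * z x" for x by (simp add: Y_def)
    \<comment> \<open>The terms in \<open>z\<close> of order l^0 add up to b -
      \<open>\<beta>\<close> (1 + m / a), which is zero by the choice of \<open>\<beta>\<close>.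
      What remains in \<open>z\<close> has both a factor \<open>m\<close> and a factor 1 /
      l.\<close>
    have mY': "of_real (m x) * Y' x = (- l * of_real (\<omega> x) + of_real (m x * (d x - \<gamma> x))
        - of_real (m x * \<beta> x * \<delta> x) / l) * Y x + of_real (m x) * g x * z x"
      if x: "0 < x" "x < X" for x
    proof -
      have xS: "x \<in> {0..X}" using x by auto
      have az: "of_real (a x) \<noteq> (0::complex)" "of_real (a x + m x) \<noteq> (0::complex)"
        using a[OF xS] am[OF xS] by (simp_all del: of_real_add)
      have bb: "of_real (b x) = of_real (\<beta> x) * of_real (\<omega> x) "
        using \<beta>[OF xS] a[OF xS] am[OF xS] unfolding \<omega>_def of_real_mult[symmetric] of_real_eq_iff
        by (simp add: field_simps)
      have om: "of_real (m x) / of_real (a x) = of_real (\<omega> x) - (1::complex)"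
        using az by (simp add: \<omega>_def field_simps)
      have z'e: "z' x = of_real (\<delta> x) * (P x * y2 x)"
        unfolding z'_def P'_def e1 by (simp add: algebra_simps)
      have "of_real (m x) * Y' x = P x * (of_real (m x) * y2' x) - of_real (m x) * (l / of_real (a x) + of_real (\<gamma> x)) * (P x * y2 x)
         - of_real (m x) * (of_real (\<beta> x) / l * z' x + of_real (\<beta>' x) / l * z x)"
        by (simp add: Y'_def P'_def algebra_simps)
      also have "P x * (of_real (m x) * y2' x) = (- l + of_real (m x * d x)) * (P x * y2 x) + of_real (b x) * z x"
        unfolding e2[OF x] z_def by (simp add: algebra_simps)
      also have "of_real (m x) * (l / of_real (a x) + of_real (\<gamma> x)) = l * (of_real (\<omega> x) - 1) + of_real (m x) * of_real (\<gamma> x)"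
        unfolding om[symmetric] by (simp add: algebra_simps)
      finally show ?thesis unfolding z'e y2Y bb g_def divide_inverse of_real_mult of_real_diff of_real_power
        using right_inverse[OF ln] by algebra
    qed
    have Y'e: "Y' x = (- l * of_real (\<omega> x) + of_real (m x * (d x - \<gamma> x))
        - of_real (m x * \<beta> x * \<delta> x) / l) * W x + g x * z x"
      if x: "0 < x" "x < X" "x \<noteq> x0" for x
    proof -
      have "of_real (m x) * Y' x = of_real (m x) * ((- l * of_real (\<omega> x) + of_real (m x * (d x - \<gamma> x))
        - of_real (m x * \<beta> x * \<delta> x) / l) * W x + g x * z x)"
        unfolding mY'[OF x(1,2)] using YW[of x] x by (simp add: algebra_simps)
      then show ?thesis using mn[of x] x by simp
    qed
    have cc2: "continuous_on {0..X} (\<lambda>x. (- l * of_real (\<omega> x) + of_real (m x * (d x - \<gamma> x))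
        - of_real (m x * \<beta> x * \<delta> x) / l) * W x + g x * z x)"
      unfolding \<omega>_def g_def using a
      by (intro ci cW cz ln) (auto simp: ln dest!: a)
    have cY'0: "isCont Y' x0"
    proof -
      have i: "isCont f x0" if "continuous_on {0..X} f" for f :: "real \<Rightarrow> 'b::topological_space"
        using that x0 by (metis at continuous_on_eq_continuous_within x0S)
      have i1: "isCont a x0" "a x0 \<noteq> 0" "isCont \<gamma> x0" "isCont \<beta> x0" "isCont \<beta>' x0" "isCont \<delta> x0" "isCont P x0" 
        "isCont y1 x0" "isCont y2 x0" "isCont z x0"
        using ca cc c\<beta> c\<beta>' cP c1 c2 cz a[OF x0S] by (auto intro!: i)
      have "isCont y1' x0" unfolding y1'_def using i1 by (intro continuous_intros) auto
      moreover have "isCont P' x0" unfolding P'_def using i1 by (intro continuous_intros) auto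
      ultimately show ?thesis unfolding Y'_def z'_def using i1 ln cy2' by (intro continuous_intros) auto
    qed
    \<comment> \<open>Two expressions for \<open>Y' x0\<close> are compared: by continuity it is the
      limit of \<open>Y'e\<close>, and by the value chosen for \<open>W\<close> at \<open>x0\<close>
      it is m' W. Their difference is the equation for \<open>W\<close> at the sonic point,
      including the damping - m'.\<close>
    have W0: "0 = (- l * of_real (\<omega> x0) - of_real (m' x0)) * W x0 + g x0 * z x0"
    proof -
      define RR where "RR = (\<lambda>x. (- l * of_real (\<omega> x) + of_real (m x * (d x - \<gamma> x))
        - of_real (m x * \<beta> x * \<delta> x) / l) * W x + g x * z x)"
      have "RR \<midarrow>x0\<rightarrow> RR x0" using cc2 x0S unfolding RR_def[symmetric]
        by (metis at continuous_on_eq_continuous_within continuous_within x0)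
      moreover have "\<forall>\<^sub>F x in at x0. RR x = Y' x"
        using Y'e eventually_at_in_open[of "{0<..<X}" x0] x0 by (auto elim!: eventually_mono simp: RR_def)
      ultimately have "Y' \<midarrow>x0\<rightarrow> RR x0" by (rule Lim_transform_eventually)
      moreover have "Y' \<midarrow>x0\<rightarrow> Y' x0" using cY'0 by (simp add: isCont_def)
      ultimately have "Y' x0 = RR x0" by (metis LIM_unique)
      moreover have "Y' x0 = of_real (m' x0) * W x0" using m0 by (simp add: W_def scaleR_conv_of_real)
      ultimately show ?thesis using m0 by (simp add: RR_def algebra_simps)
    qed
    define U where "U = (\<lambda>x. W x * of_real (th x))"
    define U' where "U' = (\<lambda>x. Y x * of_real (th x * (- K * (x - x0)) / m x - th x * m' x / (m x)\<^sup>2) + Y' x * of_real (th x / m x))"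
    have dU: "(U has_vector_derivative U' x) (at x)" if x: "0 < x" "x < X" "x \<noteq> x0" for x
    proof -
      have nz: "m x \<noteq> 0" using mn x by auto
      have mder: "(m has_real_derivative m' x) (at x)" using dm[of x] x by (simp add: at)
      have "((\<lambda>x. th x / m x) has_real_derivative (th x * (- K * (x - x0)) / m x - th x * m' x / (m x)\<^sup>2)) (at x)"
        unfolding th_def using nz
        by (auto intro!: derivative_eq_intros mder simp: field_simps power2_eq_square)
      then have "((\<lambda>x. of_real (th x / m x)) has_vector_derivative
          complex_of_real (th x * (- K * (x - x0)) / m x - th x * m' x / (m x)\<^sup>2)) (at x)"
        by (intro has_vector_derivative_of_real) (simp add: has_real_derivative_iff_has_vector_derivative)
      from has_vector_derivative_mult[OF dY[OF x(1,2)] this]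
      have "((\<lambda>x. Y x * of_real (th x / m x)) has_vector_derivative U' x) (at x)"
        by (simp add: U'_def algebra_simps)
      then show ?thesis
        by (rule has_vector_derivative_transform_within_open[of _ _ _ "{0<..<X} - {x0}"])
          (use x in \<open>auto simp: U_def W_def scaleR_conv_of_real divide_inverse mult_ac open_delete\<close>)
    qed
    define D where "D = (\<lambda>x. (m x * (d x - \<gamma> x) - m' x) - K * (m x * (x - x0)))"
    define e where "e = (\<lambda>x. - of_real (m x * \<beta> x * \<delta> x) / l)"
    define f where "f = (\<lambda>x. of_real (th x) * g x)"
    have eU: "of_real (m x) * U' x = (- l * of_real (\<omega> x) + of_real (D x) + e x) * U x + f x * z x"
      if x: "0 < x" "x < X" "x \<noteq> x0" for x
    proof -
      have nz: "m x \<noteq> 0" using mn x by auto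
      have "of_real (m x) * U' x = of_real (th x) * (Y' x - (of_real (K * (m x * (x - x0)) + m' x)) * W x)"
        unfolding U'_def YW[of x, simplified, OF conjI, OF less_imp_le less_imp_le, OF x(1,2)]
        using nz by (simp add: field_simps power2_eq_square)
      also have "\<dots> = (- l * of_real (\<omega> x) + of_real (D x) + e x) * U x + f x * z x"
        unfolding Y'e[OF x] by (simp add: D_def e_def f_def U_def algebra_simps)
      finally show ?thesis .
    qed
    have cU: "continuous_on {0..X} U" unfolding U_def by (intro continuous_intros cW cth)
    define p where "p = (\<lambda>x. complex_of_real (\<delta> x * \<beta> x) / l)"
    define r where "r = (\<lambda>x. complex_of_real (\<delta> x * m x / th x))"
    have z'eq: "z' x = p x * z x + r x * U x" if x: "0 < x" "x < X" for x
    proof -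
      have z'e: "z' x = of_real (\<delta> x) * (P x * y2 x)"
        unfolding z'_def P'_def e1 by (simp add: algebra_simps)
      have "th x \<noteq> 0" using th(1)[of x] by simp
      then show ?thesis unfolding z'e y2Y YW[of x, simplified, OF conjI, OF less_imp_le less_imp_le, OF x]
        by (simp add: p_def r_def U_def field_simps)
    qed
    have dz': "(z has_vector_derivative (p x * z x + r x * U x)) (at x)" if "0 < x" "x < X" for x
      using dz[OF that] z'eq[OF that] by simp
    have bp: "cmod (p x) \<le> M / cmod l" if "x \<in> {0..X}" for x
      using M1(2)[OF that] M1 M2 M3 M4 M5 unfolding p_def norm_divide M_def norm_of_real
      by (intro divide_right_mono) auto
    have br: "cmod (r x) \<le> M" if "x \<in> {0..X}" for x
      using M2(2)[OF that] M1 M2 M3 M4 M5 unfolding r_def M_def norm_of_real by linarith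
    have be: "cmod (e x) \<le> M / cmod l" if "x \<in> {0..X}" for x
      using M3(2)[OF that] M1 M2 M3 M4 M5 unfolding e_def norm_divide M_def norm_of_real norm_minus_cancel
      by (intro divide_right_mono) auto
    have bf: "cmod (f x) \<le> M / cmod l" if x: "x \<in> {0..X}" for x
    proof -
      have "cmod (f x) \<le> 1 * cmod (g x)" unfolding f_def norm_mult using th[of x] by (intro mult_right_mono) auto
      also have "\<dots> \<le> (M4 + M5) / cmod l" unfolding g_def norm_divide mult_1
      proof (intro divide_right_mono)
        have "cmod (of_real ((\<beta> x)\<^sup>2 * \<delta> x) / l) \<le> M5 / 1"
          unfolding norm_divide norm_of_real using M5(2)[OF x] l1 M5 by (intro frac_le) auto
        moreover have "cmod (of_real (d x * \<beta> x - \<beta>' x - \<beta> x * \<gamma> x)) \<le> M4"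
          unfolding norm_of_real using M4(2)[OF x] .
        ultimately show "cmod (of_real (d x * \<beta> x - \<beta>' x - \<beta> x * \<gamma> x) - of_real ((\<beta> x)\<^sup>2 * \<delta> x) / l) \<le> M4 + M5"
          using norm_triangle_ineq4 by (smt (verit) div_by_1)
      qed simp
      also have "\<dots> \<le> M / cmod l" using M1 M2 M3 by (intro divide_right_mono) (auto simp: M_def)
      finally show ?thesis .
    qed
    have e00: "0 = (- l * of_real (\<omega> x0) + of_real (D x0) + e x0) * U x0 + f x0 * z x0"
      using W0 m0 th0 by (simp add: D_def e_def f_def U_def)
    have \<omega>0: "\<omega> x \<ge> 0" if "x \<in> {0..X}" for x
      using a[OF that] am[OF that] by (simp add: \<omega>_def)
    have D0: "D x \<le> - (2 * \<kappa>)" if "x \<in> {0..X}" for x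
      using K2[OF that] by (simp add: D_def \<kappa>_def)
    have neg': "0 < x \<Longrightarrow> x < x0 \<Longrightarrow> m x < 0" for x using neg[of x] x0 by auto
    have pos': "x0 < x \<Longrightarrow> x < X \<Longrightarrow> m x > 0" for x using pos[of x] x0 by auto
    note est = damped_system_estimate[OF x0 cz cU dz' dU eU e00 neg' pos' \<omega>0 D0 \<kappa> M bp br be bf l(1) l1(2) l1(3)[unfolded L_def] x,
        folded L_def]
    define n where "n = cmod (z x0) / cmod l"
    have n0: "n \<ge> 0" by (simp add: n_def)
    have nle: "n \<le> cmod (z x0)" unfolding n_def using l1 lp by (simp add: divide_le_eq mult_le_cancel_left1)
    have E1: "cmod (z x - z x0) \<le> 2 * X * L * n" using est(1) by (simp add: n_def)
    have E2: "cmod (U x) \<le> 2 * M / \<kappa> * n" using est(2) by (simp add: n_def)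
    have Cn: "C / cmod l * cmod (z x0) = C * n" by (simp add: n_def)
    have zx: "cmod (z x) \<le> (1 + 2 * X * L) * cmod (z x0)"
    proof -
      have "cmod (z x) \<le> cmod (z x0) + cmod (z x - z x0)" by (metis norm_triangle_sub)
      also have "cmod (z x - z x0) \<le> 2 * X * L * cmod (z x0)"
        using E1 nle X L by (smt (verit) mult_left_mono mult_nonneg_nonneg)
      finally show ?thesis by (simp add: algebra_simps)
    qed
    have "cmod (P x * y2 x) \<le> C * n"
    proof -
      have "th x \<noteq> 0" using th(1)[of x] by simp
      then have "P x * y2 x = of_real (m x / th x) * U x + of_real (\<beta> x) / l * z x"
        unfolding y2Y YW[OF x] by (simp add: U_def field_simps)
      then have "cmod (P x * y2 x) \<le> \<bar>m x / th x\<bar> * cmod (U x) + \<bar>\<beta> x\<bar> / cmod l * cmod (z x)"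
        by (metis norm_divide norm_mult norm_of_real norm_triangle_ineq)
      also have "\<dots> \<le> M6 * (2 * M / \<kappa> * n) + M7 / cmod l * ((1 + 2 * X * L) * cmod (z x0))"
        using M6 M7 E2 zx x lp by (intro add_mono mult_mono divide_right_mono) auto
      also have "\<dots> = (M6 * (2 * M / \<kappa>) + M7 * (1 + 2 * X * L)) * n" by (simp add: n_def algebra_simps add_divide_distrib)
      also have "\<dots> \<le> C * n" unfolding C_def using X L n0 by (intro mult_right_mono) auto
      finally show ?thesis .
    qed
    moreover have "cmod (z x - z x0) \<le> C * n"
    proof -
      have "2 * X * L \<le> C" unfolding C_def using M6 M7 M \<kappa> X L by (simp add: add_nonneg_nonneg)
      then show ?thesis using E1 n0 by (meson mult_right_mono order_trans)
    qed
    ultimately show "cmod (damping A G l x * y1 x - damping A G l x0 * y1 x0)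
        \<le> C / cmod l * cmod (damping A G l x0 * y1 x0) \<and>
      cmod (damping A G l x * y2 x) \<le> C / cmod l * cmod (damping A G l x0 * y1 x0)"
      using Cn by (simp add: z_def P_def)
  qed
qed

section \<open>Coefficients of the roll wave\<close>

lemma C1_differentiable_on_inverse:
  fixes f :: "real \<Rightarrow> real"
  assumes "f C1_differentiable_on S" "\<And>x. x \<in> S \<Longrightarrow> f x \<noteq> 0"
  shows "(\<lambda>x. inverse (f x)) C1_differentiable_on S"
proof -
  obtain D where D: "\<And>x. x \<in> S \<Longrightarrow> (f has_real_derivative D x) (at x)" "continuous_on S D"
    using assms(1) unfolding C1_differentiable_on_def has_real_derivative_iff_has_vector_derivative by blast
  have cf: "continuous_on S f" using D(1) by (meson DERIV_isCont continuous_at_imp_continuous_on)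
  show ?thesis unfolding C1_differentiable_on_def has_real_derivative_iff_has_vector_derivative[symmetric]
    using D assms(2) cf
    by (intro exI[of _ "\<lambda>x. - (inverse (f x) * D x * inverse (f x))"])
      (auto intro!: continuous_intros DERIV_inverse')
qed

lemma C1_differentiable_on_divide:
  fixes f g :: "real \<Rightarrow> real"
  assumes "f C1_differentiable_on S" "g C1_differentiable_on S" "\<And>x. x \<in> S \<Longrightarrow> g x \<noteq> 0"
  shows "(\<lambda>x. f x / g x) C1_differentiable_on S"
  unfolding divide_inverse by (intro C1_differentiable_on_mult C1_differentiable_on_inverse assms)

lemma C1_differentiable_on_power:
  fixes f :: "real \<Rightarrow> real"
  assumes "f C1_differentiable_on S"
  shows "(\<lambda>x. f x ^ n) C1_differentiable_on S"
  using assms by (induction n) (auto intro: C1_differentiable_on_mult)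

lemma C1_differentiable_on_sqrt: "sqrt C1_differentiable_on {0<..}"
  unfolding C1_differentiable_on_def has_real_derivative_iff_has_vector_derivative[symmetric]
  by (intro exI[of _ "\<lambda>x. inverse (sqrt x) / 2"])
    (auto intro!: continuous_intros DERIV_real_sqrt)

locale roll_wave_profile =
  fixes F Hs Hm Hp X xs :: real and H :: "real \<Rightarrow> real"
  assumes F: "F > 2" and roll: "roll_wave F Hs Hm Hp X H"
    and xs: "0 < xs" "xs < X" and H_xs: "H xs = Hs"
begin

abbreviation c where "c \<equiv> wave_speed F Hs"
abbreviation q0 where "q0 \<equiv> wave_flux F Hs"

text \<open>All coefficients are functions of the height \<open>u = H x\<close>. The eigenvalues of the principal part
  are \<open>1 / fast u\<close> and \<open>- 1 / slow u\<close>, where only \<open>slow\<close> vanishes at the sonic height; \<open>src_v\<close>, \<open>src_h\<close>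
  are the entries of the second row of \<open>B\<^sub>1\<close>.\<close>

definition slope where
  "slope u = F\<^sup>2 * ((u\<^sup>2 + (Hs - c\<^sup>2) * u + q0\<^sup>2 / Hs) / (u\<^sup>2 + Hs * u + Hs\<^sup>2))"
definition fast where "fast u = q0 / u + sqrt u / F"
definition slow where "slow u = sqrt u / F - q0 / u"
definition fast' where "fast' u = (inverse (sqrt u) / 2 / F - q0 / u\<^sup>2) * slope u"
definition slow' where "slow' u = (inverse (sqrt u) / 2 / F + q0 / u\<^sup>2) * slope u"
definition src_v where "src_v u = 2 * (c * u - q0) / u\<^sup>2 + 2 * q0 * slope u / u\<^sup>2"
definition src_h where
  "src_h u = 1 - 2 * q0 * (c * u - q0) / u ^ 3 - (1 / F\<^sup>2 + 2 * q0\<^sup>2 / u ^ 3) * slope u"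

text \<open>The four \<open>coef\<close> functions are the zeroth-order matrix in the unknowns
  \<open>mode1\<close>, \<open>mode2\<close>; the second row belongs to the equation multiplied by
  \<open>slow\<close>. \<open>coef11\<close> turns out to be the function \<open>\<gamma>\<close> of
  the stability index, and \<open>slaved\<close> is the \<open>\<beta>\<close> of
  \<open>sonic_system_asymptotics\<close>.\<close>

definition coef11 where
  "coef11 u = (src_v u * fast u + src_h u) / (fast u * (fast u + slow u)) - fast' u / (fast u + slow u)"
definition coef12 where
  "coef12 u = (src_h u - src_v u * slow u) / (fast u * (fast u + slow u)) + slow' u / (fast u + slow u)"
definition coef21 where
  "coef21 u = (src_v u * fast u + src_h u + slow u * fast' u) / (fast u + slow u)"
definition coef22 where
  "coef22 u = (src_h u - src_v u * slow u - slow u * slow' u) / (fast u + slow u)"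
definition slaved where "slaved u = fast u * coef21 u / (fast u + slow u)"

lemma Hs_pos: "Hs > 0" and Hm_pos: "Hm > 0" and Hm_less: "Hm < Hs" and Hp_gt: "Hs < Hp" and X_pos: "X > 0"
  and H_0: "H 0 = Hm" and H_X: "H X = Hp"
proof -
  show "Hs > 0" "Hm < Hs" "Hs < Hp" "X > 0" "H 0 = Hm" "H X = Hp" using roll by (auto simp: roll_wave_def)
  have "(1 + 2 * F + sqrt (1 + 4 * F)) / (2 * F\<^sup>2) * Hs > 0"
    using F \<open>Hs > 0\<close> by (intro mult_pos_pos divide_pos_pos add_pos_pos) auto
  then show "Hm > 0" using roll by (auto simp: roll_wave_def)
qed

lemma H_pos: "x \<in> {0..X} \<Longrightarrow> H x > 0"
  using roll Hm_pos unfolding roll_wave_def by (smt (verit) atLeastAtMost_iff image_subset_iff)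

lemma H_less: "x \<in> {0..X} \<Longrightarrow> y \<in> {0..X} \<Longrightarrow> x < y \<Longrightarrow> H x < H y"
  using roll unfolding roll_wave_def strict_mono_on_def by blast

lemma DERIV_H: "x \<in> {0..X} \<Longrightarrow> (H has_real_derivative slope (H x)) (at x within {0..X})"
  using roll unfolding roll_wave_def slope_def by blast

lemma continuous_on_H: "continuous_on {0..X} H"
  using DERIV_H by (rule DERIV_continuous_on)

lemma q0_pos: "q0 > 0" using Hs_pos F by (simp add: wave_flux_def)

lemma q0_eq: "q0 = sqrt Hs ^ 3 / F"
proof -
  have "Hs powr (3/2) = (Hs powr (1/2)) powr 3" by (simp add: powr_powr)
  also have "\<dots> = sqrt Hs ^ 3" using Hs_pos by (simp add: powr_half_sqrt powr_numeral)
  finally show ?thesis by (simp add: wave_flux_def)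
qed

lemma fast_pos: "u > 0 \<Longrightarrow> fast u > 0"
  using q0_pos F by (simp add: fast_def add_pos_pos)

lemma fast_plus_slow: "fast u + slow u = 2 * sqrt u / F" by (simp add: fast_def slow_def)

lemma fast_minus_slow: "fast u - slow u = 2 * q0 / u" by (simp add: fast_def slow_def)

lemma fast_plus_slow_pos: "u > 0 \<Longrightarrow> fast u + slow u > 0"
  using F by (simp add: fast_plus_slow)

lemma fast_slow: "u > 0 \<Longrightarrow> fast u * slow u = u / F\<^sup>2 - q0\<^sup>2 / u\<^sup>2"
  using F by (simp add: fast_def slow_def field_simps power2_eq_square)

text \<open>As a difference of cubes, the speed visibly has the sign of u - Hs.\<close>

lemma slow_eq: "u > 0 \<Longrightarrow> slow u = (sqrt u ^ 3 - sqrt Hs ^ 3) / (F * u)"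
proof -
  assume u: "u > 0"
  then have "sqrt u ^ 3 = u * sqrt u" by (simp add: power3_eq_cube)
  then show ?thesis using u F by (simp add: slow_def q0_eq field_simps)
qed

lemma slow_neg: "0 < u \<Longrightarrow> u < Hs \<Longrightarrow> slow u < 0"
  using F by (auto simp: slow_eq divide_less_0_iff power_strict_mono)

lemma slow_pos: "Hs < u \<Longrightarrow> slow u > 0"
  using F Hs_pos by (auto simp: slow_eq power_strict_mono)

lemma slow_Hs: "slow Hs = 0" using Hs_pos by (simp add: slow_eq)

lemma slope_Hs: "slope Hs = F * (F - 2) / 3"
proof -
  \<comment> \<open>In terms of \<open>k\<close> and \<open>F\<close> all quantities are rational,
    so the claim becomes a field identity.\<close>
  define k where "k = sqrt Hs"
  have k: "k > 0" "Hs = k\<^sup>2" using Hs_pos by (simp_all add: k_def)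
  have qc: "q0 = k ^ 3 / F" "c = k * (1 + 1 / F)" by (simp_all add: q0_eq wave_speed_def k_def)
  show ?thesis unfolding slope_def qc unfolding k(2) using k(1) F
    by (simp add: field_simps power2_eq_square power3_eq_cube)
qed

text \<open>\<open>src_h\<close> is r_h + c r_q - m'. Differentiating the profile equation m H' =
  r(H, Q) with respect to the height shows that it vanishes where m does. Consequently
  \<open>coef22\<close> vanishes at the sonic height, its other terms having the factor
  \<open>slow\<close>.\<close>

lemma src_h_Hs: "src_h Hs = 0"
proof -
  define k where "k = sqrt Hs"
  have k: "k > 0" "Hs = k\<^sup>2" using Hs_pos by (simp_all add: k_def)
  have qc: "q0 = k ^ 3 / F" "c = k * (1 + 1 / F)" by (simp_all add: q0_eq wave_speed_def k_def)
  show ?thesis unfolding src_h_def slope_Hs qc unfolding k(2) using k(1) F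
    by (simp add: field_simps power2_eq_square power3_eq_cube)
qed

text \<open>This is the damping rate at the sonic point; its sign rests on F > 2 through
  \<open>slope_Hs\<close>.\<close>

lemma slow'_Hs_pos: "slow' Hs > 0"
  unfolding slow'_def slope_Hs using F Hs_pos q0_pos by (intro mult_pos_pos add_pos_pos) auto

lemma DERIV_fast: "u > 0 \<Longrightarrow> (fast has_real_derivative (inverse (sqrt u) / 2 / F - q0 / u\<^sup>2)) (at u)"
  unfolding fast_def using F by (auto intro!: derivative_eq_intros simp: field_simps power2_eq_square)

lemma DERIV_slow: "u > 0 \<Longrightarrow> (slow has_real_derivative (inverse (sqrt u) / 2 / F + q0 / u\<^sup>2)) (at u)"
  unfolding slow_def using F by (auto intro!: derivative_eq_intros simp: field_simps power2_eq_square)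

lemma DERIV_comp_H:
  assumes "(f has_real_derivative f') (at (H x))" "x \<in> {0..X}"
  shows "((\<lambda>x. f (H x)) has_real_derivative f' * slope (H x)) (at x within {0..X})"
  using DERIV_chain2[OF assms(1) DERIV_H[OF assms(2)]] .

lemma DERIV_fast_H: "x \<in> {0..X} \<Longrightarrow> ((\<lambda>x. fast (H x)) has_real_derivative fast' (H x)) (at x within {0..X})"
  unfolding fast'_def by (intro DERIV_comp_H DERIV_fast H_pos)

lemma DERIV_slow_H: "x \<in> {0..X} \<Longrightarrow> ((\<lambda>x. slow (H x)) has_real_derivative slow' (H x)) (at x within {0..X})"
  unfolding slow'_def by (intro DERIV_comp_H DERIV_slow H_pos)

lemma C1_ident: "(\<lambda>u::real. u) C1_differentiable_on S" by simp

lemmas C1_intros = C1_differentiable_on_add C1_differentiable_on_diff C1_differentiable_on_mult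
  C1_differentiable_on_divide C1_differentiable_on_power C1_differentiable_on_sqrt
  C1_differentiable_on_const C1_ident C1_differentiable_on_inverse

lemma C1_slope: "slope C1_differentiable_on {0<..}"
proof -
  have "u\<^sup>2 + Hs * u + Hs\<^sup>2 > 0" if "u > 0" for u
    using that Hs_pos by (simp add: add_pos_pos)
  then show ?thesis unfolding slope_def by (intro C1_intros) force
qed

lemma C1_fast: "fast C1_differentiable_on {0<..}"
  unfolding fast_def using F by (intro C1_intros) auto

lemma C1_slow: "slow C1_differentiable_on {0<..}"
  unfolding slow_def using F by (intro C1_intros) auto

lemma C1_fast': "fast' C1_differentiable_on {0<..}"
  unfolding fast'_def using F by (intro C1_intros C1_slope) auto

lemma C1_slow': "slow' C1_differentiable_on {0<..}"
  unfolding slow'_def using F by (intro C1_intros C1_slope) auto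

lemma C1_src_v: "src_v C1_differentiable_on {0<..}"
  unfolding src_v_def using F by (intro C1_intros C1_slope) auto

lemma C1_src_h: "src_h C1_differentiable_on {0<..}"
  unfolding src_h_def using F by (intro C1_intros C1_slope) auto

lemma C1_coef:
  "coef11 C1_differentiable_on {0<..}" "coef12 C1_differentiable_on {0<..}"
  "coef21 C1_differentiable_on {0<..}" "coef22 C1_differentiable_on {0<..}"
  "slaved C1_differentiable_on {0<..}"
proof -
  have nz: "fast u \<noteq> 0" "fast u + slow u \<noteq> 0" if "u \<in> {0<..}" for u
    using fast_pos[of u] fast_plus_slow_pos[of u] that by auto
  note C1 = C1_intros C1_fast C1_slow C1_fast' C1_slow' C1_src_v C1_src_h
  show "coef11 C1_differentiable_on {0<..}" "coef12 C1_differentiable_on {0<..}"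
    and 21: "coef21 C1_differentiable_on {0<..}" and "coef22 C1_differentiable_on {0<..}"
    unfolding coef11_def coef12_def coef21_def coef22_def by (intro C1; use nz in simp)+
  show "slaved C1_differentiable_on {0<..}"
    unfolding slaved_def by (intro C1 21; use nz in simp)
qed

lemma C1_comp_H:
  assumes "f C1_differentiable_on {0<..}"
  obtains f' where "\<And>x. x \<in> {0..X} \<Longrightarrow> ((\<lambda>x. f (H x)) has_real_derivative f' x) (at x within {0..X})"
    and "continuous_on {0..X} f'" and "continuous_on {0..X} (\<lambda>x. f (H x))"
proof -
  obtain D where D: "\<And>x. x \<in> {0<..} \<Longrightarrow> (f has_real_derivative D x) (at x)" "continuous_on {0<..} D"
    using assms(1) unfolding C1_differentiable_on_def has_real_derivative_iff_has_vector_derivative by blast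
  have im: "H ` {0..X} \<subseteq> {0<..}" using H_pos by auto
  have sl: "continuous_on {0<..} slope"
    using C1_differentiable_imp_continuous_on[OF C1_slope] .
  have 1: "((\<lambda>x. f (H x)) has_real_derivative D (H x) * slope (H x)) (at x within {0..X})"
    if "x \<in> {0..X}" for x using D(1) H_pos[OF that] that by (intro DERIV_comp_H) auto
  have 2: "continuous_on {0..X} (\<lambda>x. D (H x) * slope (H x))"
    by (intro continuous_on_mult continuous_on_compose2[OF D(2) continuous_on_H im]
        continuous_on_compose2[OF sl continuous_on_H im])
  show thesis by (rule that[OF 1 2 DERIV_continuous_on[OF 1]])
qed

lemma continuous_on_comp_H:
  fixes f :: "real \<Rightarrow> real"
  assumes "f C1_differentiable_on {0<..}"
  shows "continuous_on {0..X} (\<lambda>x. f (H x))"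
  by (rule C1_comp_H[OF assms])

end

section \<open>The eigenvalue equations\<close>

text \<open>Continuity of the derivative across the sonic point is the purpose: it lets the slow
  equation, once divided by its speed, be evaluated there as a limit.\<close>

lemma real_analytic_on_imp_C1:
  assumes "real_analytic_on f {a..b}"
  obtains f' where "continuous_on {a..b} f" "continuous_on {a..b} f'"
    "\<And>x. a < x \<Longrightarrow> x < b \<Longrightarrow> (f has_vector_derivative f' x) (at x)"
proof -
  obtain g where g: "g analytic_on (complex_of_real ` {a..b})" "\<And>x. x \<in> {a..b} \<Longrightarrow> g (of_real x) = f x"
    using assms unfolding real_analytic_on_def by blast
  have co: "continuous_on {a..b} (\<lambda>x. k (of_real x))" if "k analytic_on (complex_of_real ` {a..b})" for k
    using analytic_imp_holomorphic[OF that, THEN holomorphic_on_imp_continuous_on]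
    by (rule continuous_on_compose2) (auto intro!: continuous_intros)
  show thesis
  proof (rule that)
    show "continuous_on {a..b} f" using continuous_on_cong[OF refl g(2)] co[OF g(1)] by fast
    show "continuous_on {a..b} (\<lambda>x. deriv g (of_real x))" by (intro co analytic_deriv g(1))
    show "(f has_vector_derivative deriv g (of_real x)) (at x)" if x: "a < x" "x < b" for x
    proof -
      have "(g has_field_derivative deriv g (of_real x)) (at (of_real x))"
        using analytic_on_imp_differentiable_at[OF g(1)] x by (auto simp: DERIV_deriv_iff_field_differentiable)
      then have "((\<lambda>x. g (of_real x)) has_vector_derivative deriv g (of_real x)) (at x)"
        by (rule has_vector_derivative_real_field)
      then show ?thesis
        by (rule has_vector_derivative_transform_within_open[of _ _ _ "{a<..<b}"]) (use x g in auto)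
    qed
  qed
qed

section \<open>The eigenvalue equations in the unknowns v = c h - q and h\<close>

context roll_wave_profile
begin

lemma at_cell: "0 < x \<Longrightarrow> x < X \<Longrightarrow> at x within {0..X} = at x"
  by (simp add: at_within_Icc_at)

lemma has_vector_derivative_of_real_cell:
  assumes "(f has_real_derivative f') (at x within {0..X})" "0 < x" "x < X"
  shows "((\<lambda>x. of_real (f x)) has_vector_derivative complex_of_real f') (at x)"
  using assms by (simp add: at_cell has_real_derivative_iff_has_vector_derivative has_vector_derivative_of_real)

definition sonic :: "real \<Rightarrow> real" where "sonic u = u / F\<^sup>2 - q0\<^sup>2 / u\<^sup>2"

lemma DERIV_sonic: "u > 0 \<Longrightarrow> (sonic has_real_derivative 1 / F\<^sup>2 + 2 * q0\<^sup>2 / u ^ 3) (at u)"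
  unfolding sonic_def using F
  by (auto intro!: derivative_eq_intros simp: field_simps power2_eq_square power3_eq_cube)

text \<open>In h and v the coefficient of h becomes the sonic function m, because Q = c H -
  q0.\<close>

lemma lin_flux2_eq:
  assumes "x \<in> {0..X}"
  shows "lin_flux2 F Hs H h q x = of_real (sonic (H x)) * h x
    + (of_real (2 * q0 / H x) - of_real c) * (of_real c * h x - q x)"
proof -
  have u: "H x > 0" using H_pos[OF assms] .
  have 1: "flux_coeff_q F Hs H x = c - 2 * q0 / H x"
    using u by (simp add: flux_coeff_q_def discharge_def field_simps)
  have 2: "flux_coeff_h F Hs H x = sonic (H x) + 2 * q0 / H x * c - c * c"
    using u F by (simp add: flux_coeff_h_def discharge_def sonic_def field_simps power2_eq_square)
  show ?thesis unfolding lin_flux2_def 1 2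
    by (simp add: algebra_simps add_divide_distrib diff_divide_distrib)
qed

text \<open>The first equation reads v' = l h, which eliminates v' from the second. What is left
  determines h' only up to the factor m, and \<open>src_v\<close>, \<open>src_h\<close> collect the
  source together with the derivatives of the coefficients.\<close>

lemma eigen_height_equation:
  assumes eig: "eigen_system F Hs X H l h q" and x: "0 < x" "x < X"
    and dh: "(h has_vector_derivative h') (at x)" and dq: "(q has_vector_derivative q') (at x)"
  defines "v \<equiv> of_real c * h x - q x" and "u \<equiv> H x"
  shows "of_real c * h' - q' = l * h x"
    and "of_real (sonic u) * h' = l * v - of_real (2 * q0 / u) * l * h x
      + of_real (src_v u) * v + of_real (src_h u) * h x"
proof -
  have xS: "x \<in> {0..X}" using x by auto
  have u: "u > 0" using H_pos[OF xS] by (simp add: u_def)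
  have "(lin_flux1 F Hs h q has_vector_derivative - of_real c * h' + q') (at x)"
    unfolding lin_flux1_def by (auto intro!: derivative_eq_intros dh dq)
  then have "vector_derivative (lin_flux1 F Hs h q) (at x) = - of_real c * h' + q'"
    by (rule vector_derivative_at)
  then show 1: "of_real c * h' - q' = l * h x"
    using eig x unfolding eigen_system_def by (auto simp: algebra_simps add_eq_0_iff)
  have ds: "((\<lambda>x. of_real (sonic (H x))) has_vector_derivative
      complex_of_real ((1 / F\<^sup>2 + 2 * q0\<^sup>2 / u ^ 3) * slope u)) (at x)"
    unfolding u_def using DERIV_comp_H[OF DERIV_sonic[OF H_pos[OF xS]] xS] x
    by (rule has_vector_derivative_of_real_cell)
  have dr: "((\<lambda>x. of_real (2 * q0 / H x)) has_vector_derivative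
      complex_of_real (- (2 * q0 / u\<^sup>2) * slope u)) (at x)"
  proof -
    have "((\<lambda>u. 2 * q0 / u) has_real_derivative - (2 * q0 / (H x)\<^sup>2)) (at (H x))"
      using H_pos[OF xS] by (auto intro!: derivative_eq_intros simp: power2_eq_square)
    from DERIV_comp_H[OF this xS] x show ?thesis unfolding u_def
      by (rule has_vector_derivative_of_real_cell)
  qed
  have dv: "((\<lambda>x. of_real c * h x - q x) has_vector_derivative l * h x) (at x)"
    unfolding 1[symmetric] by (auto intro!: derivative_eq_intros dh dq)
  have "((\<lambda>x. of_real (sonic (H x)) * h x + (of_real (2 * q0 / H x) - of_real c) * (of_real c * h x - q x))
     has_vector_derivative
       (of_real (sonic u) * h' + of_real ((1 / F\<^sup>2 + 2 * q0\<^sup>2 / u ^ 3) * slope u) * h x)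
       + ((of_real (2 * q0 / u) - of_real c) * (l * h x) + (of_real (- (2 * q0 / u\<^sup>2) * slope u) - 0) * v)) (at x)"
    unfolding v_def u_def
    by (intro has_vector_derivative_add has_vector_derivative_mult has_vector_derivative_diff
        has_vector_derivative_const ds[unfolded u_def] dr[unfolded u_def] dv dh)
  then have "(lin_flux2 F Hs H h q has_vector_derivative
       (of_real (sonic u) * h' + of_real ((1 / F\<^sup>2 + 2 * q0\<^sup>2 / u ^ 3) * slope u) * h x)
       + ((of_real (2 * q0 / u) - of_real c) * (l * h x) + (of_real (- (2 * q0 / u\<^sup>2) * slope u) - 0) * v)) (at x)"
    by (rule has_vector_derivative_transform_within_open[of _ _ _ "{0<..<X}"])
      (use x in \<open>auto simp: lin_flux2_eq\<close>)
  then have "l * q x + ((of_real (sonic u) * h' + of_real ((1 / F\<^sup>2 + 2 * q0\<^sup>2 / u ^ 3) * slope u) * h x)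
       + ((of_real (2 * q0 / u) - of_real c) * (l * h x) + (of_real (- (2 * q0 / u\<^sup>2) * slope u) - 0) * v))
     = h x - of_real (2 * discharge F Hs H x / (H x)\<^sup>2) * q x
          + of_real (2 * (discharge F Hs H x)\<^sup>2 / (H x)^3) * h x"
    using eig x unfolding eigen_system_def by (metis greaterThanLessThan_iff vector_derivative_at)
  moreover have "q x = of_real c * h x - v" by (simp add: v_def)
  moreover have "discharge F Hs H x = c * u - q0" by (simp add: discharge_def u_def)
  ultimately have eq: "l * (of_real c * h x - v) + ((of_real (sonic u) * h' + of_real ((1 / F\<^sup>2 + 2 * q0\<^sup>2 / u ^ 3) * slope u) * h x)
       + ((of_real (2 * q0 / u) - of_real c) * (l * h x) + (of_real (- (2 * q0 / u\<^sup>2) * slope u) - 0) * v))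
     = h x - of_real (2 * (c * u - q0) / u\<^sup>2) * (of_real c * h x - v)
          + of_real (2 * (c * u - q0)\<^sup>2 / u ^ 3) * h x"
    by (simp add: u_def)
  \<comment> \<open>Both coefficients are expanded into the very terms that occur in
    \<open>eq\<close>, so that the claim is a polynomial rearrangement of it.\<close>
  have sv: "src_v u = 2 * (c * u - q0) / u\<^sup>2 - (- (2 * q0 / u\<^sup>2) * slope u)"
    by (simp add: src_v_def)
  have sh: "src_h u = 1 - 2 * (c * u - q0) / u\<^sup>2 * c + 2 * (c * u - q0)\<^sup>2 / u ^ 3
      - (1 / F\<^sup>2 + 2 * q0\<^sup>2 / u ^ 3) * slope u"
    unfolding src_h_def using u by (simp add: field_simps power2_eq_square power3_eq_cube)
  show "of_real (sonic u) * h' = l * v - of_real (2 * q0 / u) * l * h x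
      + of_real (src_v u) * v + of_real (src_h u) * h x"
    unfolding sv sh of_real_diff[of _ "_ * slope u"] of_real_add[of _ "_ / u ^ 3"] 
      of_real_diff[of 1] of_real_mult[of _ c] using eq by (simp only: of_real_1) algebra
qed

end

text \<open>Quotient rule for y1 = (v + m h) / (a + m), with h = y1 + y2 and v = a y1 - m y2
  substituted back. Only the product m h' occurs, so the identity holds at the sonic point as
  well.\<close>

lemma mode1_identity:
  fixes a m a' m' bv bh l h h' v v' :: complex
  assumes "a \<noteq> 0" "a + m \<noteq> 0" and v': "v' = l * h"
    and h': "a * m * h' = l * v - (a - m) * l * h + bv * v + bh * h"
  shows "((v' + (m' * h + m * h')) * (a + m) - (v + m * h) * (a' + m')) / (a + m)\<^sup>2
    = (l / a + ((bv * a + bh) / (a * (a + m)) - a' / (a + m))) * ((v + m * h) / (a + m))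
      + ((bh - bv * m) / (a * (a + m)) + m' / (a + m)) * ((a * h - v) / (a + m))"
proof -
  \<comment> \<open>With the inverses as named unknowns the goal is a polynomial identity.\<close>
  define i j where "i = inverse (a + m)" and "j = inverse a"
  have ij: "(a + m) * i = 1" "a * j = 1" using assms by (simp_all add: i_def j_def)
  have "m * h' = j * (l * v - (a - m) * l * h + bv * v + bh * h)"
    using h' ij by algebra
  then show ?thesis
    unfolding divide_inverse inverse_mult_distrib power2_eq_square i_def[symmetric] j_def[symmetric] v'
    using ij by algebra
qed

text \<open>The derivative of y2 = (a h - v) / (a + m) contains a h', whereas the equations
  determine only m h'; hence the factor m on the left.\<close>

lemma mode2_identity:
  fixes a m a' m' bv bh l h h' v v' :: complex
  assumes "a + m \<noteq> 0" and v': "v' = l * h"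
    and h': "a * m * h' = l * v - (a - m) * l * h + bv * v + bh * h"
  shows "m * (((a * h' + a' * h - v') * (a + m) - (a * h - v) * (a' + m')) / (a + m)\<^sup>2)
    = (- l + (bh - bv * m - m * m') / (a + m)) * ((a * h - v) / (a + m))
      + (bv * a + bh + m * a') / (a + m) * ((v + m * h) / (a + m))"
proof -
  define i where "i = inverse (a + m)"
  have i: "(a + m) * i = 1" using assms by (simp add: i_def)
  show ?thesis
    unfolding divide_inverse inverse_mult_distrib power2_eq_square i_def[symmetric] v'
    using i h' by algebra
qed

text \<open>Here \<open>w\<close> is an unknown common amplitude that cancels in the quotient. The
  bound on \<open>\<epsilon>\<close> keeps |eX| above half of its leading term, whence the factor
  2.\<close>

lemma quotient_of_approximations:
  fixes e0 eX w :: complex and a0 aX \<epsilon> :: real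
  assumes "a0 > 0" "aX > 0" "w \<noteq> 0" and \<epsilon>: "\<epsilon> \<le> aX / 2"
    and e0: "cmod (e0 - of_real a0 * w) \<le> \<epsilon> * cmod w" and eX: "cmod (eX - of_real aX * w) \<le> \<epsilon> * cmod w"
  shows "eX \<noteq> 0" and "cmod (e0 / eX * of_real (aX / a0) - 1) \<le> 2 * (a0 + aX) / (a0 * aX) * \<epsilon>"
proof -
  have wp: "cmod w > 0" using assms by simp
  have "aX * cmod w = cmod (of_real aX * w)" using assms by (simp add: norm_mult)
  also have "\<dots> \<le> cmod eX + cmod (eX - of_real aX * w)" by (metis norm_minus_commute norm_triangle_sub)
  also have "\<dots> \<le> cmod eX + aX / 2 * cmod w"
    using eX mult_right_mono[OF \<epsilon>, of "cmod w"] by simp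
  finally have lo: "aX / 2 * cmod w \<le> cmod eX" by (simp add: field_simps)
  have "aX / 2 * cmod w > 0" using assms wp by simp
  then show nz: "eX \<noteq> 0" using lo by auto
  have "e0 / eX * of_real (aX / a0) - 1
      = ((e0 - of_real a0 * w) * of_real aX - of_real a0 * (eX - of_real aX * w)) / (eX * of_real a0)"
    using nz assms by (simp add: field_simps)
  also have "cmod \<dots> = cmod ((e0 - of_real a0 * w) * of_real aX - of_real a0 * (eX - of_real aX * w)) / (cmod eX * a0)"
    using assms by (simp add: norm_divide norm_mult)
  also have "\<dots> \<le> (\<epsilon> * cmod w * (a0 + aX)) / (aX / 2 * cmod w * a0)"
  proof (intro frac_le mult_right_mono lo)
    have "cmod ((e0 - of_real a0 * w) * of_real aX - of_real a0 * (eX - of_real aX * w))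
       \<le> cmod (e0 - of_real a0 * w) * aX + a0 * cmod (eX - of_real aX * w)"
      using norm_triangle_ineq4[of "(e0 - of_real a0 * w) * of_real aX" "of_real a0 * (eX - of_real aX * w)"] assms
      by (simp add: norm_mult)
    also have "\<dots> \<le> \<epsilon> * cmod w * aX + a0 * (\<epsilon> * cmod w)"
      using assms by (intro add_mono mult_right_mono mult_left_mono) auto
    finally show "cmod ((e0 - of_real a0 * w) * of_real aX - of_real a0 * (eX - of_real aX * w)) \<le> \<epsilon> * cmod w * (a0 + aX)"
      by (simp add: algebra_simps)
    show "0 \<le> \<epsilon> * cmod w * (a0 + aX)"
      using order_trans[OF norm_ge_zero e0] assms(1,2) by (intro mult_nonneg_nonneg[of "\<epsilon> * cmod w"]) linarith+
  qed (use assms wp in auto)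
  also have "\<dots> = 2 * (a0 + aX) / (a0 * aX) * \<epsilon>" using wp assms by (simp add: field_simps)
  finally show "cmod (e0 / eX * of_real (aX / a0) - 1) \<le> 2 * (a0 + aX) / (a0 * aX) * \<epsilon>" .
qed

section \<open>The two modes and their asymptotics\<close>

context roll_wave_profile
begin

text \<open>\<open>phase X\<close> is the time the fast mode takes to cross the cell, the T of the
  final estimates.\<close>

definition phase :: "real \<Rightarrow> real" where "phase x = integral {0..x} (\<lambda>y. 1 / fast (H y))"
definition growth :: "real \<Rightarrow> real" where "growth x = integral {0..x} (\<lambda>y. coef11 (H y))"

text \<open>\<open>mode1\<close> and \<open>mode2\<close> are the coordinates of (v, h) with respect
  to the columns of \<open>P0\<close>.\<close>

definition mode1 :: "(real \<Rightarrow> complex) \<Rightarrow> (real \<Rightarrow> complex) \<Rightarrow> real \<Rightarrow> complex" where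
  "mode1 h q x = (of_real c * h x - q x + of_real (slow (H x)) * h x)
    / (of_real (fast (H x)) + of_real (slow (H x)))"
definition mode2 :: "(real \<Rightarrow> complex) \<Rightarrow> (real \<Rightarrow> complex) \<Rightarrow> real \<Rightarrow> complex" where
  "mode2 h q x = (of_real (fast (H x)) * h x - (of_real c * h x - q x))
    / (of_real (fast (H x)) + of_real (slow (H x)))"

lemma fast_plus_slow_nz:
  assumes "x \<in> {0..X}"
  shows "complex_of_real (fast (H x)) \<noteq> 0" "complex_of_real (fast (H x)) + of_real (slow (H x)) \<noteq> 0"
  using fast_pos[OF H_pos[OF assms]] fast_plus_slow_pos[OF H_pos[OF assms]]
  by (auto simp: of_real_add[symmetric] simp del: of_real_add)

lemma modes_inverse:
  assumes "x \<in> {0..X}"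
  shows "mode1 h q x + mode2 h q x = h x"
    and "of_real (fast (H x)) * mode1 h q x - of_real (slow (H x)) * mode2 h q x = of_real c * h x - q x"
  unfolding mode1_def mode2_def divide_inverse
  using right_inverse[OF fast_plus_slow_nz(2)[OF assms]] by algebra+

lemma sonic_eq: "u > 0 \<Longrightarrow> sonic u = fast u * slow u"
  by (simp add: fast_slow sonic_def)

text \<open>The derivative of \<open>mode2\<close> is kept as an explicit quotient
  \<open>z2'\<close>: its equation determines it only where \<open>slow\<close> does not vanish,
  while the quotient is visibly continuous across the sonic point.\<close>

lemma mode_derivatives:
  assumes eig: "eigen_system F Hs X H l h q" and x: "0 < x" "x < X"
    and dh: "(h has_vector_derivative h') (at x)" and dq: "(q has_vector_derivative q') (at x)"
  defines "a \<equiv> complex_of_real (fast (H x))" and "m \<equiv> complex_of_real (slow (H x))"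
    and "a' \<equiv> complex_of_real (fast' (H x))" and "m' \<equiv> complex_of_real (slow' (H x))"
    and "v \<equiv> of_real c * h x - q x"
  defines "z2' \<equiv> ((a * h' + a' * h x - l * h x) * (a + m) - (a * h x - v) * (a' + m')) / (a + m)\<^sup>2"
  shows "(mode1 h q has_vector_derivative
      ((l / a + of_real (coef11 (H x))) * mode1 h q x + of_real (coef12 (H x)) * mode2 h q x)) (at x)"
    and "(mode2 h q has_vector_derivative z2') (at x)"
    and "m * z2' = (- l + of_real (coef22 (H x))) * mode2 h q x + of_real (coef21 (H x)) * mode1 h q x"
proof -
  have xS: "x \<in> {0..X}" using x by auto
  have nz: "a \<noteq> 0" "a + m \<noteq> 0" using fast_plus_slow_nz[OF xS] by (simp_all add: a_def m_def)
  note eq = eigen_height_equation[OF eig x dh dq]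
  have h': "a * m * h' = l * v - (a - m) * l * h x + of_real (src_v (H x)) * v + of_real (src_h (H x)) * h x"
    using eq(2) unfolding sonic_eq[OF H_pos[OF xS]] fast_minus_slow[symmetric]
    by (simp add: a_def m_def v_def)
  have da: "((\<lambda>x. complex_of_real (fast (H x))) has_vector_derivative a') (at x)"
    unfolding a'_def by (rule has_vector_derivative_of_real_cell[OF DERIV_fast_H[OF xS] x])
  have dm: "((\<lambda>x. complex_of_real (slow (H x))) has_vector_derivative m') (at x)"
    unfolding m'_def by (rule has_vector_derivative_of_real_cell[OF DERIV_slow_H[OF xS] x])
  have dv: "((\<lambda>x. of_real c * h x - q x) has_vector_derivative l * h x) (at x)"
    unfolding eq(1)[symmetric] by (auto intro!: derivative_eq_intros dh dq)
  have quot: "((\<lambda>x. f x / g x) has_vector_derivative (f' * g x - f x * g') / (g x)\<^sup>2) (at x)"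
    if "(f has_vector_derivative f') (at x)" "(g has_vector_derivative g') (at x)" "g x \<noteq> 0"
    for f g :: "real \<Rightarrow> complex" and f' g'
  proof -
    have "((\<lambda>x. inverse (g x)) has_vector_derivative g' * - (inverse (g x) ^ Suc (Suc 0))) (at x)"
      using field_vector_diff_chain_at[OF that(2) DERIV_inverse[OF that(3)]] by (simp add: o_def)
    from has_vector_derivative_mult[OF that(1) this] show ?thesis
      using that(3) by (simp add: divide_inverse power2_eq_square algebra_simps)
  qed
  note dsum = has_vector_derivative_add[OF da dm]
  have nz': "complex_of_real (fast (H x)) + complex_of_real (slow (H x)) \<noteq> 0"
    using nz by (simp add: a_def m_def)
  have "(mode1 h q has_vector_derivative
      ((l * h x + (m * h' + m' * h x)) * (a + m) - (v + m * h x) * (a' + m')) / (a + m)\<^sup>2) (at x)"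
    unfolding mode1_def
    using quot[OF has_vector_derivative_add[OF dv has_vector_derivative_mult[OF dm dh]] dsum nz']
    by (simp add: a_def m_def v_def)
  moreover have "((l * h x + (m * h' + m' * h x)) * (a + m) - (v + m * h x) * (a' + m')) / (a + m)\<^sup>2
     = (l / a + of_real (coef11 (H x))) * mode1 h q x + of_real (coef12 (H x)) * mode2 h q x"
    using mode1_identity[OF nz refl h', of m' a']
    by (simp add: mode1_def mode2_def coef11_def coef12_def a_def m_def a'_def m'_def v_def add.commute)
  ultimately show "(mode1 h q has_vector_derivative
      ((l / a + of_real (coef11 (H x))) * mode1 h q x + of_real (coef12 (H x)) * mode2 h q x)) (at x)"
    by simp
  show "(mode2 h q has_vector_derivative z2') (at x)"
    unfolding mode2_def z2'_def
    using quot[OF has_vector_derivative_diff[OF has_vector_derivative_mult[OF da dh] dv] dsum nz']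
    by (simp add: a_def m_def v_def)
  show "m * z2' = (- l + of_real (coef22 (H x))) * mode2 h q x + of_real (coef21 (H x)) * mode1 h q x"
    unfolding z2'_def mode2_identity[OF nz(2) refl h', of a' m']
    by (simp add: mode1_def mode2_def coef21_def coef22_def a_def m_def a'_def m'_def v_def)
qed

lemma mode_asymptotics:
  obtains C R where "C > 0" "R > 0"
    "\<And>l h q x. Re l \<ge> 0 \<Longrightarrow> cmod l \<ge> R \<Longrightarrow> real_analytic_on h {0..X} \<Longrightarrow> real_analytic_on q {0..X} \<Longrightarrow>
      eigen_system F Hs X H l h q \<Longrightarrow> x \<in> {0..X} \<Longrightarrow>
      cmod (damping phase growth l x * mode1 h q x - damping phase growth l xs * mode1 h q xs)
        \<le> C / cmod l * cmod (damping phase growth l xs * mode1 h q xs) \<and>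
      cmod (damping phase growth l x * mode2 h q x)
        \<le> C / cmod l * cmod (damping phase growth l xs * mode1 h q xs)"
proof -
  have xsS: "xs \<in> {0..X}" using xs by auto
  note cH = continuous_on_comp_H
  have c22: "continuous_on {0..X} (\<lambda>x. coef22 (H x))" by (intro cH C1_coef)
  have cs: "continuous_on {0..X} (\<lambda>x. slow (H x))" by (intro cH C1_slow)
  \<comment> \<open>The vanishing of \<open>coef22\<close> at the simple zero of \<open>slow\<close>
    gives a continuous quotient \<open>d\<close>, as required by
    \<open>sonic_system_asymptotics\<close>.\<close>
  have "coef22 Hs = 0" by (simp add: coef22_def slow_Hs src_h_Hs)
  then obtain d where d: "continuous_on {0..X} d" "\<And>x. x \<in> {0..X} \<Longrightarrow> coef22 (H x) = slow (H x) * d x"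
  proof -
    assume c0: "coef22 Hs = 0"
    obtain f' where f': "\<And>x. x \<in> {0..X} \<Longrightarrow> ((\<lambda>x. coef22 (H x)) has_real_derivative f' x) (at x within {0..X})"
      using C1_comp_H[OF C1_coef(4)] by blast
    have nz: "slow (H x) \<noteq> 0" if "x \<in> {0..X}" "x \<noteq> xs" for x
      using H_less[OF that(1) xsS] H_less[OF xsS that(1)] that(2) slow_neg[of "H x"] slow_pos[of "H x"] H_pos[OF that(1)] H_xs
      by (cases "x < xs") auto
    define d where "d x = (if x = xs then f' xs /\<^sub>R slow' Hs else coef22 (H x) /\<^sub>R slow (H x))" for x
    have "continuous_on {0..X} d" unfolding d_def
      by (rule continuous_on_quotient_simple_zero[OF c22 cs xsS])
        (use nz H_xs slow_Hs c0 slow'_Hs_pos f'[OF xsS] DERIV_slow_H[OF xsS] in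
          \<open>auto simp: has_real_derivative_iff_has_vector_derivative\<close>)
    moreover have "coef22 (H x) = slow (H x) * d x" if "x \<in> {0..X}" for x
      using nz[OF that] c0 H_xs slow_Hs by (auto simp: d_def)
    ultimately show thesis using that by blast
  qed
  obtain \<beta>' where \<beta>': "\<And>x. x \<in> {0..X} \<Longrightarrow> ((\<lambda>x. slaved (H x)) has_real_derivative \<beta>' x) (at x within {0..X})"
      "continuous_on {0..X} \<beta>'"
    using C1_comp_H[OF C1_coef(5)] by blast
  have cf: "continuous_on {0..X} (\<lambda>x. fast (H x))" by (intro cH C1_fast)
  have fp: "fast (H x) > 0" if "x \<in> {0..X}" for x by (intro fast_pos H_pos that)
  have cinv: "continuous_on {0..X} (\<lambda>x. 1 / fast (H x))"
    using fp by (intro continuous_intros cf) force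
  have dphase: "(phase has_real_derivative 1 / fast (H x)) (at x within {0..X})" if "x \<in> {0..X}" for x
    unfolding phase_def by (rule integral_has_real_derivative[OF cinv that])
  have c11: "continuous_on {0..X} (\<lambda>x. coef11 (H x))" by (intro cH C1_coef)
  have dgrowth: "(growth has_real_derivative coef11 (H x)) (at x within {0..X})" if "x \<in> {0..X}" for x
    unfolding growth_def by (rule integral_has_real_derivative[OF c11 that])
  have c12: "continuous_on {0..X} (\<lambda>x. coef12 (H x))" by (intro cH C1_coef)
  have csl': "continuous_on {0..X} (\<lambda>x. slow' (H x))" by (intro cH C1_slow')
  have neg: "slow (H x) < 0" if "x \<in> {0..X}" "x < xs" for x
    using H_less[OF that(1) xsS that(2)] H_pos[OF that(1)] H_xs by (intro slow_neg) auto
  have pos: "slow (H x) > 0" if "x \<in> {0..X}" "xs < x" for x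
    using H_less[OF xsS that] H_xs by (intro slow_pos) auto
  have sum: "fast (H x) + slow (H x) > 0" if "x \<in> {0..X}" for x
    using fast_plus_slow_pos[OF H_pos[OF that]] .
  have sl0: "slow (H xs) = 0" "slow' (H xs) > 0" using H_xs slow_Hs slow'_Hs_pos by simp_all
  obtain C R where CR: "C > 0" "R > 0" and *: "\<And>l y1 y2 x. Re l \<ge> 0 \<Longrightarrow> cmod l \<ge> R \<Longrightarrow>
      sonic_system_solution X xs (\<lambda>x. fast (H x)) (\<lambda>x. slow (H x)) (\<lambda>x. coef11 (H x)) (\<lambda>x. coef12 (H x))
        (\<lambda>x. coef21 (H x)) (\<lambda>x. slow (H x) * d x) l y1 y2 \<Longrightarrow> x \<in> {0..X} \<Longrightarrow>
      cmod (damping phase growth l x * y1 x - damping phase growth l xs * y1 xs)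
        \<le> C / cmod l * cmod (damping phase growth l xs * y1 xs) \<and>
      cmod (damping phase growth l x * y2 x) \<le> C / cmod l * cmod (damping phase growth l xs * y1 xs)"
    using sonic_system_asymptotics[OF xs DERIV_slow_H csl' sl0 neg pos cf fp sum c11 c12 d(1) \<beta>' slaved_def dphase dgrowth]
    by blast
  show thesis
  proof (rule that[OF CR])
    fix l h q x
    assume l: "Re l \<ge> 0" "cmod l \<ge> R" and an: "real_analytic_on h {0..X}" "real_analytic_on q {0..X}"
      and eig: "eigen_system F Hs X H l h q" and x: "x \<in> {0..X}"
    obtain h' where h': "continuous_on {0..X} h" "continuous_on {0..X} h'"
      "\<And>x. 0 < x \<Longrightarrow> x < X \<Longrightarrow> (h has_vector_derivative h' x) (at x)"
      using real_analytic_on_imp_C1[OF an(1)] by blast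
    obtain q' where q': "continuous_on {0..X} q" "continuous_on {0..X} q'"
      "\<And>x. 0 < x \<Longrightarrow> x < X \<Longrightarrow> (q has_vector_derivative q' x) (at x)"
      using real_analytic_on_imp_C1[OF an(2)] by blast
    define z2' where "z2' x = ((of_real (fast (H x)) * h' x + of_real (fast' (H x)) * h x - l * h x)
         * (of_real (fast (H x)) + of_real (slow (H x)))
         - (of_real (fast (H x)) * h x - (of_real c * h x - q x)) * (of_real (fast' (H x)) + of_real (slow' (H x))))
      / (of_real (fast (H x)) + of_real (slow (H x)))\<^sup>2" for x
    have cfa': "continuous_on {0..X} (\<lambda>x. fast' (H x))" by (intro cH C1_fast')
    have "continuous_on {0..X} z2'" unfolding z2'_def using fast_plus_slow_nz
      by (intro continuous_intros cf cs csl' cfa' h' q') auto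
    then have "isCont z2' xs" using at_cell[OF xs] xsS by (metis continuous_on_eq_continuous_within)
    moreover have "continuous_on {0..X} (mode1 h q)" "continuous_on {0..X} (mode2 h q)"
      unfolding mode1_def mode2_def using fast_plus_slow_nz
      by (intro continuous_intros cf cs h' q'; auto)+
    moreover note md = mode_derivatives[OF eig _ _ h'(3) q'(3), folded z2'_def]
    have "of_real (slow (H x)) * z2' x
        = (- l + of_real (slow (H x) * d x)) * mode2 h q x + of_real (coef21 (H x)) * mode1 h q x"
      if "0 < x" "x < X" for x using md(3)[OF that that that] d(2)[of x] that by simp
    ultimately have "sonic_system_solution X xs (\<lambda>x. fast (H x)) (\<lambda>x. slow (H x)) (\<lambda>x. coef11 (H x)) (\<lambda>x. coef12 (H x))
        (\<lambda>x. coef21 (H x)) (\<lambda>x. slow (H x) * d x) l (mode1 h q) (mode2 h q)"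
      unfolding sonic_system_solution_def using md(1,2) by (intro conjI exI[of _ z2']) auto
    from *[OF l this x]
    show "cmod (damping phase growth l x * mode1 h q x - damping phase growth l xs * mode1 h q xs)
        \<le> C / cmod l * cmod (damping phase growth l xs * mode1 h q xs) \<and>
      cmod (damping phase growth l x * mode2 h q x)
        \<le> C / cmod l * cmod (damping phase growth l xs * mode1 h q xs)" .
  qed
qed

end

section \<open>The determinant\<close>

context roll_wave_profile
begin

text \<open>Adding multiples of the first row to the second row of the determinant leaves the jump of
  \<open>evans_flux\<close>; \<open>jump_ratio\<close> is \<open>{r} / {H}\<close>.\<close>

definition jump_ratio :: real where
  "jump_ratio = (source Hp (c * Hp - q0) - source Hm (c * Hm - q0)) / (Hp - Hm)"

definition evans_flux :: "complex \<Rightarrow> (real \<Rightarrow> complex) \<Rightarrow> (real \<Rightarrow> complex) \<Rightarrow> real \<Rightarrow> complex" where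
  "evans_flux l h q x = of_real (sonic (H x)) * h x
     + (of_real (2 * q0 / H x) - of_real jump_ratio / l) * (of_real c * h x - q x)"

text \<open>Origin of the squares in the index: with m = fast slow and 2 q0 / H = fast - slow the
  mixed products cancel. The part with \<open>jump_ratio\<close> carries 1 / l and is an error
  term.\<close>

lemma evans_flux_modes:
  assumes "x \<in> {0..X}"
  shows "evans_flux l h q x = of_real ((fast (H x))\<^sup>2) * mode1 h q x + of_real ((slow (H x))\<^sup>2) * mode2 h q x
    - of_real jump_ratio / l * (of_real (fast (H x)) * mode1 h q x - of_real (slow (H x)) * mode2 h q x)"
  unfolding evans_flux_def sonic_eq[OF H_pos[OF assms]] fast_minus_slow[symmetric]
    modes_inverse(2)[OF assms, of h q, symmetric]
  unfolding modes_inverse(1)[OF assms, of h q, symmetric]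
  by (simp add: algebra_simps power2_eq_square)

lemma evans_flux_asymptotics:
  obtains C R where "C > 0" "R > 0"
    "\<And>l h q x. Re l \<ge> 0 \<Longrightarrow> cmod l \<ge> R \<Longrightarrow> real_analytic_on h {0..X} \<Longrightarrow> real_analytic_on q {0..X} \<Longrightarrow>
      eigen_system F Hs X H l h q \<Longrightarrow> h xs \<noteq> 0 \<Longrightarrow>
      \<exists>w. w \<noteq> 0 \<and> (\<forall>x\<in>{0..X}. cmod (damping phase growth l x * evans_flux l h q x
        - of_real ((fast (H x))\<^sup>2) * w) \<le> C / cmod l * cmod w)"
proof -
  obtain C0 R0 where CR: "C0 > 0" "R0 > 0" and est:
    "\<And>l h q x. Re l \<ge> 0 \<Longrightarrow> cmod l \<ge> R0 \<Longrightarrow> real_analytic_on h {0..X} \<Longrightarrow> real_analytic_on q {0..X} \<Longrightarrow>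
      eigen_system F Hs X H l h q \<Longrightarrow> x \<in> {0..X} \<Longrightarrow>
      cmod (damping phase growth l x * mode1 h q x
        - damping phase growth l xs * mode1 h q xs)
        \<le> C0 / cmod l * cmod (damping phase growth l xs * mode1 h q xs) \<and>
      cmod (damping phase growth l x * mode2 h q x)
        \<le> C0 / cmod l * cmod (damping phase growth l xs * mode1 h q xs)"
    using mode_asymptotics by blast
  obtain M1 where M1: "M1 > 0" "\<And>x. x \<in> {0..X} \<Longrightarrow> \<bar>fast (H x)\<bar> \<le> M1"
    using continuous_on_Icc_bounded[OF continuous_on_comp_H[OF C1_fast]] by blast
  obtain M2 where M2: "M2 > 0" "\<And>x. x \<in> {0..X} \<Longrightarrow> \<bar>slow (H x)\<bar> \<le> M2"
    using continuous_on_Icc_bounded[OF continuous_on_comp_H[OF C1_slow]] by blast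
  define C where "C = M1\<^sup>2 * C0 + M2\<^sup>2 * C0 + \<bar>jump_ratio\<bar> * (M1 * (1 + C0) + M2 * C0)"
  show thesis
  proof (rule that[of C "R0 + 1"])
    show "C > 0" "R0 + 1 > 0" using CR M1 M2 by (auto simp: C_def intro!: add_pos_nonneg)
    fix l h q
    assume l: "Re l \<ge> 0" "cmod l \<ge> R0 + 1" and an: "real_analytic_on h {0..X}" "real_analytic_on q {0..X}"
      and eig: "eigen_system F Hs X H l h q" and hxs: "h xs \<noteq> 0"
    have l1: "cmod l \<ge> R0" "cmod l \<ge> 1" using l CR by auto
    define P where "P = damping phase growth l"
    define w where "w = P xs * mode1 h q xs"
    have P: "P x \<noteq> 0" for x by (simp add: P_def damping_def)
    note est = est[OF l(1) l1(1) an eig, folded P_def, folded w_def]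
    \<comment> \<open>If the amplitude vanished, the estimate would force the slow mode to vanish at
      the sonic point too, and then h would be zero there.\<close>
    have w: "w \<noteq> 0"
    proof
      assume w0: "w = 0"
      then have "mode1 h q xs = 0" using P by (simp add: w_def)
      moreover have "mode2 h q xs = 0" using est[of xs] xs P w0 by simp
      ultimately show False using modes_inverse(1)[of xs h q] xs hxs by simp
    qed
    have "cmod (P x * evans_flux l h q x - of_real ((fast (H x))\<^sup>2) * w) \<le> C / cmod l * cmod w"
      if x: "x \<in> {0..X}" for x
    proof -
      define n where "n = cmod w / cmod l"
      define z1 z2 where "z1 = P x * mode1 h q x" and "z2 = P x * mode2 h q x"
      have lp: "cmod l > 0" using l1 by linarith
      have n0: "n \<ge> 0" by (simp add: n_def)
      have nw: "n \<le> cmod w" using l1 lp by (simp add: n_def divide_le_eq mult_le_cancel_left1)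
      have e1: "cmod (z1 - w) \<le> C0 * n" and e2: "cmod z2 \<le> C0 * n"
        using est[OF x] by (simp_all add: z1_def z2_def n_def)
      have z1: "cmod z1 \<le> (1 + C0) * cmod w"
      proof -
        have "cmod z1 \<le> cmod w + cmod (z1 - w)" by (metis norm_triangle_sub)
        also have "\<dots> \<le> cmod w + C0 * cmod w" using e1 mult_left_mono[OF nw, of C0] CR by linarith
        finally show ?thesis by (simp add: algebra_simps)
      qed
      have z2: "cmod z2 \<le> C0 * cmod w" using e2 mult_left_mono[OF nw, of C0] CR by linarith
      have "P x * evans_flux l h q x - of_real ((fast (H x))\<^sup>2) * w
        = of_real ((fast (H x))\<^sup>2) * (z1 - w) + of_real ((slow (H x))\<^sup>2) * z2
          - of_real jump_ratio / l * (of_real (fast (H x)) * z1 - of_real (slow (H x)) * z2)"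
        unfolding evans_flux_modes[OF x] z1_def z2_def by (simp add: algebra_simps)
      also have "cmod \<dots> \<le> (fast (H x))\<^sup>2 * cmod (z1 - w) + (slow (H x))\<^sup>2 * cmod z2
          + \<bar>jump_ratio\<bar> / cmod l * (\<bar>fast (H x)\<bar> * cmod z1 + \<bar>slow (H x)\<bar> * cmod z2)"
      proof (rule order_trans[OF norm_triangle_ineq4 add_mono])
        show "cmod (of_real ((fast (H x))\<^sup>2) * (z1 - w) + of_real ((slow (H x))\<^sup>2) * z2)
          \<le> (fast (H x))\<^sup>2 * cmod (z1 - w) + (slow (H x))\<^sup>2 * cmod z2"
          by (rule order_trans[OF norm_triangle_ineq]) (simp add: norm_mult norm_power)
        have "cmod (of_real (fast (H x)) * z1 - of_real (slow (H x)) * z2)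
          \<le> \<bar>fast (H x)\<bar> * cmod z1 + \<bar>slow (H x)\<bar> * cmod z2"
          by (rule order_trans[OF norm_triangle_ineq4]) (simp add: norm_mult)
        then show "cmod (of_real jump_ratio / l * (of_real (fast (H x)) * z1 - of_real (slow (H x)) * z2))
          \<le> \<bar>jump_ratio\<bar> / cmod l * (\<bar>fast (H x)\<bar> * cmod z1 + \<bar>slow (H x)\<bar> * cmod z2)"
          unfolding norm_mult norm_divide norm_of_real by (intro mult_left_mono) auto
      qed
      also have "\<dots> \<le> M1\<^sup>2 * (C0 * n) + M2\<^sup>2 * (C0 * n)
          + \<bar>jump_ratio\<bar> / cmod l * (M1 * ((1 + C0) * cmod w) + M2 * (C0 * cmod w))"
      proof -
        have "(fast (H x))\<^sup>2 \<le> M1\<^sup>2" "(slow (H x))\<^sup>2 \<le> M2\<^sup>2"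
          using M1 M2 x by (auto simp: abs_le_square_iff[symmetric])
        then show ?thesis using e1 e2 z1 z2 M1 M2 x CR n0
          by (intro add_mono mult_mono order_refl) auto
      qed
      also have "\<dots> = C / cmod l * cmod w" by (simp add: C_def n_def algebra_simps add_divide_distrib)
      finally show ?thesis .
    qed
    then show "\<exists>w. w \<noteq> 0 \<and> (\<forall>x\<in>{0..X}. cmod (damping phase growth l x * evans_flux l h q x
        - of_real ((fast (H x))\<^sup>2) * w) \<le> C / cmod l * cmod w)"
      using w unfolding P_def by blast
  qed
qed

lemma phase_X_pos: "phase X > 0"
proof -
  have cf: "continuous_on {0..X} (\<lambda>x. fast (H x))" by (intro continuous_on_comp_H C1_fast)
  have fp: "fast (H x) > 0" if "x \<in> {0..X}" for x by (intro fast_pos H_pos that)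
  have cinv: "continuous_on {0..X} (\<lambda>x. 1 / fast (H x))"
    using fp by (intro continuous_intros cf) force
  have "phase X \<noteq> 0" unfolding phase_def
    using integral_eq_0_iff[OF cinv] fp X_pos
    by (metis atLeastAtMost_iff less_eq_real_def less_numeral_extra(3) order_refl zero_less_divide_1_iff)
  moreover have "phase X \<ge> 0" unfolding phase_def
    by (intro integral_nonneg integrable_continuous_real cinv) (use fp in \<open>auto intro: less_imp_le\<close>)
  ultimately show ?thesis by linarith
qed

definition index :: real where "index = (fast Hm / fast Hp)\<^sup>2 * exp (- growth X)"

lemma Hp_pos: "Hp > 0" using Hs_pos Hp_gt by linarith

lemma index_pos: "index > 0"
  using fast_pos[OF Hm_pos] fast_pos[OF Hp_pos] by (simp add: index_def)

text \<open>Taking the ratio of the two ends removes the unknown amplitude; the damping factor,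
  equal to 1 at 0, contributes exp (l T) and \<open>growth X\<close> at the other end.\<close>

lemma index_asymptotics:
  obtains C R where "C > 0" "R > 0"
    "\<And>l h q. Re l \<ge> 0 \<Longrightarrow> cmod l \<ge> R \<Longrightarrow> real_analytic_on h {0..X} \<Longrightarrow> real_analytic_on q {0..X} \<Longrightarrow>
      eigen_system F Hs X H l h q \<Longrightarrow> h xs \<noteq> 0 \<Longrightarrow>
      evans_flux l h q X \<noteq> 0 \<and>
      cmod (evans_flux l h q 0 / evans_flux l h q X * exp (l * of_real (phase X)) / of_real index - 1) \<le> C / cmod l"
proof -
  obtain C0 R0 where CR: "C0 > 0" "R0 > 0" and est:
    "\<And>l h q x. Re l \<ge> 0 \<Longrightarrow> cmod l \<ge> R0 \<Longrightarrow> real_analytic_on h {0..X} \<Longrightarrow> real_analytic_on q {0..X} \<Longrightarrow>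
      eigen_system F Hs X H l h q \<Longrightarrow> h xs \<noteq> 0 \<Longrightarrow>
      \<exists>w. w \<noteq> 0 \<and> (\<forall>x\<in>{0..X}. cmod (damping phase growth l x * evans_flux l h q x
        - of_real ((fast (H x))\<^sup>2) * w) \<le> C0 / cmod l * cmod w)"
    using evans_flux_asymptotics by blast
  define a0 aX where "a0 = (fast Hm)\<^sup>2" and "aX = (fast Hp)\<^sup>2"
  have a: "a0 > 0" "aX > 0" using fast_pos[OF Hm_pos] fast_pos[OF Hp_pos] by (auto simp: a0_def aX_def)
  define C where "C = 2 * (a0 + aX) / (a0 * aX) * C0"
  have C: "C > 0" using a CR by (simp add: C_def)
  define R where "R = R0 + 2 * C0 / aX"
  show thesis
  proof (rule that[of C R])
    show "C > 0" "R > 0" using C CR a by (auto simp: R_def intro!: add_pos_pos)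
    fix l h q
    assume l: "Re l \<ge> 0" "cmod l \<ge> R" and an: "real_analytic_on h {0..X}" "real_analytic_on q {0..X}"
      and eig: "eigen_system F Hs X H l h q" and hxs: "h xs \<noteq> 0"
    have "2 * C0 / aX > 0" using CR a by simp
    then have l1: "cmod l \<ge> R0" "cmod l \<ge> 2 * C0 / aX" "cmod l > 0" using l CR unfolding R_def by linarith+
    obtain w where w: "w \<noteq> 0" "\<And>x. x \<in> {0..X} \<Longrightarrow> cmod (damping phase growth l x * evans_flux l h q x
        - of_real ((fast (H x))\<^sup>2) * w) \<le> C0 / cmod l * cmod w"
      using est[OF l(1) l1(1) an eig hxs] by blast
    define e0 eX where "e0 = damping phase growth l 0 * evans_flux l h q 0"
      and "eX = damping phase growth l X * evans_flux l h q X"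
    have e: "cmod (e0 - of_real a0 * w) \<le> C0 / cmod l * cmod w" "cmod (eX - of_real aX * w) \<le> C0 / cmod l * cmod w"
      using w(2)[of 0] w(2)[of X] X_pos H_0 H_X by (auto simp: e0_def eX_def a0_def aX_def)
    have small: "C0 / cmod l \<le> aX / 2" using l1 a by (simp add: field_simps)
    note q = quotient_of_approximations[OF a w(1) small e]
    have nz: "evans_flux l h q X \<noteq> 0" using q(1) by (simp add: eX_def)
    have "e0 = evans_flux l h q 0" by (simp add: e0_def phase_def growth_def damping_def)
    then have "e0 / eX * of_real (aX / a0)
      = evans_flux l h q 0 / evans_flux l h q X * exp (l * of_real (phase X)) / of_real index"
      using nz a fast_pos[OF Hm_pos] fast_pos[OF Hp_pos] unfolding eX_def a0_def aX_def index_def damping_def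
      by (simp add: exp_minus exp_diff field_simps exp_of_real power_divide)
    then show "evans_flux l h q X \<noteq> 0 \<and>
      cmod (evans_flux l h q 0 / evans_flux l h q X * exp (l * of_real (phase X)) / of_real index - 1) \<le> C / cmod l"
      using nz q(2) by (simp add: C_def)
  qed
qed

section \<open>Reduction of the determinant to a condition on moduli\<close>

lemma Lim_cell:
  assumes "continuous_on {0..X} f"
  shows "Lim (at_left X) f = f X" "Lim (at_right 0) f = f 0"
proof -
  have "(f \<longlongrightarrow> f X) (at_left X)" "(f \<longlongrightarrow> f 0) (at_right 0)"
    using assms X_pos unfolding continuous_on_def
    by (metis at_within_Icc_at_left at_within_Icc_at_right atLeastAtMost_iff less_imp_le order_refl)+
  then show "Lim (at_left X) f = f X" "Lim (at_right 0) f = f 0"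
    by (auto intro!: tendsto_Lim)
qed

text \<open>Subtracting c - jump_ratio / z times the first row from the second makes the matrix
  triangular, because {Q} = c {H} and {r} = jump_ratio {H}.\<close>

lemma evans_lopatinsky_eq:
  assumes "z \<noteq> 0" "continuous_on {0..X} (h z)" "continuous_on {0..X} (q z)"
  shows "evans_lopatinsky F Hs X H h q z \<xi> = z * of_real (Hp - Hm)
    * (evans_flux z (h z) (q z) X - exp (\<i> * of_real (\<xi> * X)) * evans_flux z (h z) (q z) 0)"
proof -
  have H0: "H x \<noteq> 0" if "x \<in> {0..X}" for x using H_pos[OF that] by simp
  have S: "0 \<in> {0..X}" "X \<in> {0..X}" using X_pos by auto
  have cQ: "continuous_on {0..X} (discharge F Hs H)"
    unfolding discharge_def by (intro continuous_intros continuous_on_H)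
  have c1: "continuous_on {0..X} (\<lambda>x. z * of_real (H x))"
    by (intro continuous_intros continuous_on_H)
  have c2: "continuous_on {0..X} (\<lambda>x. z * of_real (discharge F Hs H x)
      - of_real (H x - (discharge F Hs H x)\<^sup>2 / (H x)\<^sup>2))"
    using H0 by (intro continuous_intros continuous_on_H cQ) auto
  have c3: "continuous_on {0..X} (lin_flux1 F Hs (h z) (q z))"
    unfolding lin_flux1_def by (intro continuous_intros assms)
  have c4: "continuous_on {0..X} (lin_flux2 F Hs H (h z) (q z))"
    unfolding lin_flux2_def flux_coeff_q_def flux_coeff_h_def using H0 F
    by (intro continuous_intros assms continuous_on_H cQ) auto
  have e: "lin_flux2 F Hs H (h z) (q z) x = evans_flux z (h z) (q z) x
      - (of_real c - of_real jump_ratio / z) * (of_real c * h z x - q z x)" if "x \<in> {0..X}" for x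
    unfolding lin_flux2_eq[OF that] evans_flux_def by (simp add: algebra_simps)
  have J: "complex_of_real (Hp - Hm) * of_real jump_ratio
      = of_real (source Hp (c * Hp - q0)) - of_real (source Hm (c * Hm - q0))"
  proof -
    have "(Hp - Hm) * jump_ratio = source Hp (c * Hp - q0) - source Hm (c * Hm - q0)"
      unfolding jump_ratio_def using Hm_less Hp_gt by simp
    then show ?thesis by (metis of_real_mult of_real_diff)
  qed
  have zz: "z * inverse z = 1" using assms by simp
  show ?thesis
    unfolding evans_lopatinsky_def det_2 vector_2 jump_def bloch_jump_def Lim_cell[OF c1] Lim_cell[OF c2]
      Lim_cell[OF c3] Lim_cell[OF c4] e[OF S(1)] e[OF S(2)] lin_flux1_def H_0 H_X
    using J zz unfolding discharge_def source_def H_0 H_X divide_inverse of_real_diff of_real_mult by algebra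
qed

text \<open>The interval for \<open>\<xi>\<close> has length 2 pi / X, so the Floquet factor takes
  every value on the unit circle; \<open>Arg\<close> of the quotient provides the exponent.\<close>

lemma exists_rotation_iff:
  fixes a b :: complex
  shows "(\<exists>\<xi>\<in>{- pi / X..pi / X}. a = exp (\<i> * of_real (\<xi> * X)) * b) \<longleftrightarrow> cmod a = cmod b"
proof
  assume "\<exists>\<xi>\<in>{- pi / X..pi / X}. a = exp (\<i> * of_real (\<xi> * X)) * b"
  then show "cmod a = cmod b" by (auto simp: norm_mult norm_exp_i_times)
next
  assume ab: "cmod a = cmod b"
  show "\<exists>\<xi>\<in>{- pi / X..pi / X}. a = exp (\<i> * of_real (\<xi> * X)) * b"
  proof (cases "b = 0")
    case True
    then show ?thesis using ab X_pos by (intro bexI[of _ 0]) auto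
  next
    case False
    then have nz: "a / b \<noteq> 0" using ab by auto
    have n1: "cmod (a / b) = 1" using ab False by (simp add: norm_divide)
    have "exp (\<i> * of_real (Arg (a / b) / X * X)) = a / b"
      using Arg_eq[OF nz] n1 X_pos by simp
    then show ?thesis
      using X_pos False Arg_bounded[of "a / b"]
      by (intro bexI[of _ "Arg (a / b) / X"]) (auto simp: divide_right_mono field_simps)
  qed
qed

end

section \<open>Level curves\<close>

text \<open>With \<open>e = Ln \<Phi> / T\<close> the level set is \<open>Re z = ln I / T + Re (e z)\<close>. Since \<open>e\<close> and, by Cauchy's
  inequality, its derivative are small far out, \<open>z = ln I / T + \<i> s + e z\<close> has a unique solution,
  which depends on \<open>s\<close> in a Lipschitz way.\<close>

lemma unbounded_level_curve:
  fixes \<Phi> :: "complex \<Rightarrow> complex" and I T R C :: real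
  assumes "I > 1" "T > 0" "C > 0"
    and hol: "\<Phi> holomorphic_on {z. Re z > 0 \<and> cmod z > R}"
    and bd: "\<And>z. Re z > 0 \<Longrightarrow> cmod z > R \<Longrightarrow> cmod (\<Phi> z - 1) \<le> C / cmod z"
  obtains g :: "real \<Rightarrow> complex" where "continuous_on {0..} g"
    and "\<And>t. t \<ge> 0 \<Longrightarrow> Re (g t) > 0 \<and> cmod (g t) > R \<and> cmod (of_real I * \<Phi> (g t)) = exp (T * Re (g t))"
    and "filterlim g at_infinity at_top" and "((\<lambda>t. Re (g t)) \<longlongrightarrow> ln I / T) at_top"
proof -
  define \<eta> where "\<eta> = ln I / T"
  have \<eta>: "\<eta> > 0" using assms by (simp add: \<eta>_def)
  \<comment> \<open>Beyond this radius |\<open>\<Phi>\<close> - 1| < 1/2, so that \<open>Ln\<close>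
    is holomorphic along \<open>\<Phi>\<close>, and the last summand gives |e| at most
    \<open>\<eta>\<close> / 8.\<close>
  define R1 where "R1 = \<bar>R\<bar> + 3 * C + 16 * C / (T * \<eta>)"
  have tp: "16 * C / (T * \<eta>) > 0" using assms \<eta> by simp
  have R1: "R1 > R" "R1 > 2 * C" "R1 \<ge> 16 * C / (T * \<eta>)" "R1 > 0"
    using tp assms by (auto simp: R1_def)
  define e where "e z = Ln (\<Phi> z) / of_real T" for z
  define D where "D = {z. Re z > 0 \<and> cmod z > R1}"
  have "D = {z. Re z > 0} \<inter> - cball 0 R1" by (auto simp: D_def)
  then have oD: "open D" using open_halfspace_Re_gt[of 0] by (auto intro!: open_Int)
  have half: "cmod (\<Phi> z - 1) < 1 / 2" if "z \<in> D" for z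
  proof -
    have "cmod z > 0" "2 * C < cmod z" using that R1 by (auto simp: D_def)
    then have "C / cmod z < 1 / 2" by (simp add: field_simps)
    then show ?thesis using bd[of z] that R1 by (intro order_le_less_trans[OF bd]) (auto simp: D_def)
  qed
  have pos: "Re (\<Phi> z) > 0" if "z \<in> D" for z
    using half[OF that] abs_Re_le_cmod[of "\<Phi> z - 1"] by auto
  have eb: "cmod (e z) \<le> 2 * C / T / cmod z" if "z \<in> D" for z
  proof -
    have "cmod (Ln (\<Phi> z)) \<le> 2 * cmod (\<Phi> z - 1)"
      using norm_Ln_le[OF half[OF that]] by simp
    also have "\<dots> \<le> 2 * (C / cmod z)" using bd[of z] that R1 by (auto simp: D_def)
    finally have "cmod (Ln (\<Phi> z)) / T \<le> 2 * (C / cmod z) / T"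
      using assms by (intro divide_right_mono) auto
    then show ?thesis using assms by (simp add: e_def norm_divide mult_ac)
  qed
  have es: "cmod (e z) \<le> \<eta> / 8" if z: "z \<in> D" for z
  proof -
    have "16 * C / (T * \<eta>) \<le> cmod z" "cmod z > 0" using z R1 by (auto simp: D_def)
    then have "2 * C / T / cmod z \<le> \<eta> / 8" using assms \<eta> by (simp add: field_simps)
    then show ?thesis using eb[OF z] by linarith
  qed
  have eh: "e holomorphic_on D"
  proof -
    have "\<Phi> holomorphic_on D" by (rule holomorphic_on_subset[OF hol]) (use R1 in \<open>auto simp: D_def\<close>)
    moreover have "\<Phi> z \<notin> \<real>\<^sub>\<le>\<^sub>0" if "z \<in> D" for z
      using pos[OF that] by (auto simp: complex_nonpos_Reals_iff)
    ultimately show ?thesis unfolding e_def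
      using assms by (intro holomorphic_intros) auto
  qed
  \<comment> \<open>An intersection of half planes, hence convex as the mean value estimate
    requires, with a margin that keeps discs of radius \<open>\<eta>\<close> / 4 inside
    \<open>D\<close>.\<close>
  define V where "V = {z. Re z \<ge> \<eta> / 2} \<inter> {z. Im z \<ge> R1 + \<eta> / 2}"
  have VD: "cball z (\<eta> / 4) \<subseteq> D" if "z \<in> V" for z
  proof
    fix w assume "w \<in> cball z (\<eta> / 4)"
    then have "cmod (w - z) \<le> \<eta> / 4" by (simp add: dist_norm norm_minus_commute)
    then have "\<bar>Re w - Re z\<bar> \<le> \<eta> / 4" "\<bar>Im w - Im z\<bar> \<le> \<eta> / 4"
      using abs_Re_le_cmod[of "w - z"] abs_Im_le_cmod[of "w - z"] by auto
    then have "Re w > 0" "Im w > R1" using that \<eta> unfolding V_def Int_iff mem_Collect_eq by linarith+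
    then show "w \<in> D" using abs_Im_le_cmod[of w] by (auto simp: D_def)
  qed
  \<comment> \<open>Cauchy's inequality: the bound \<open>\<eta>\<close> / 8 over the radius
    \<open>\<eta>\<close> / 4 gives the contraction constant 1/2.\<close>
  have de: "cmod (deriv e z) \<le> 1 / 2" if z: "z \<in> V" for z
  proof -
    have "cmod ((deriv ^^ 1) e z) \<le> fact 1 * (\<eta> / 8) / (\<eta> / 4) ^ 1"
    proof (rule Cauchy_inequality)
      show "e holomorphic_on ball z (\<eta> / 4)" using VD[OF z]
        by (intro holomorphic_on_subset[OF eh]) auto
      show "continuous_on (cball z (\<eta> / 4)) e" using VD[OF z]
        by (intro holomorphic_on_imp_continuous_on holomorphic_on_subset[OF eh]) auto
      show "cmod (e w) \<le> \<eta> / 8" if "cmod (z - w) = \<eta> / 4" for w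
        using VD[OF z] that by (intro es) (auto simp: dist_norm)
    qed (use \<eta> in auto)
    then show ?thesis using \<eta> by simp
  qed
  have lip: "cmod (e x - e y) \<le> 1 / 2 * cmod (x - y)" if "x \<in> V" "y \<in> V" for x y
  proof (rule field_differentiable_bound[where S = V and f' = "deriv e"])
    show "convex V" unfolding V_def by (intro convex_Int convex_halfspace_Re_ge convex_halfspace_Im_ge)
    show "(e has_field_derivative deriv e z) (at z within V)" if "z \<in> V" for z
      using holomorphic_derivI[OF eh oD, of z] VD[OF that] \<eta> by (auto simp: subset_iff)
  qed (use de that in auto)
  define K where "K t = cball (Complex \<eta> (R1 + \<eta> + t)) (\<eta> / 4)" for t
  have KV: "K t \<subseteq> V" if "t \<ge> 0" for t
  proof
    fix w assume "w \<in> K t"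
    then have "cmod (w - Complex \<eta> (R1 + \<eta> + t)) \<le> \<eta> / 4" by (simp add: K_def dist_norm norm_minus_commute)
    then have "\<bar>Re w - \<eta>\<bar> \<le> \<eta> / 4" "\<bar>Im w - (R1 + \<eta> + t)\<bar> \<le> \<eta> / 4"
      using abs_Re_le_cmod[of "w - Complex \<eta> (R1 + \<eta> + t)"] abs_Im_le_cmod[of "w - Complex \<eta> (R1 + \<eta> + t)"] by auto
    then show "w \<in> V" using that \<eta> unfolding V_def Int_iff mem_Collect_eq by linarith
  qed
  have "\<exists>z. z \<in> K t \<and> Complex \<eta> (R1 + \<eta> + t) + e z = z" if t: "t \<ge> 0" for t
  proof -
    have "\<exists>!z\<in>K t. Complex \<eta> (R1 + \<eta> + t) + e z = z"
    proof (rule Banach_fix[where c = "1 / 2"])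
      show "complete (K t)" by (simp add: K_def compact_imp_complete)
      show "K t \<noteq> {}" using \<eta> by (simp add: K_def)
      show "(\<lambda>z. Complex \<eta> (R1 + \<eta> + t) + e z) ` K t \<subseteq> K t"
      proof (intro image_subsetI)
        fix z assume "z \<in> K t"
        then have "z \<in> D" using KV[OF t] VD[of z] \<eta> by (auto simp: subset_iff)
        then show "Complex \<eta> (R1 + \<eta> + t) + e z \<in> K t" using es[of z] \<eta> by (simp add: K_def dist_norm)
      qed
      show "dist (Complex \<eta> (R1 + \<eta> + t) + e x) (Complex \<eta> (R1 + \<eta> + t) + e y) \<le> 1 / 2 * dist x y"
        if "x \<in> K t" "y \<in> K t" for x y
        using lip[of x y] KV[OF t] that by (auto simp: dist_norm)
    qed auto
    then show ?thesis by blast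
  qed
  then obtain g where g: "\<And>t. t \<ge> 0 \<Longrightarrow> g t \<in> K t \<and> Complex \<eta> (R1 + \<eta> + t) + e (g t) = g t"
    by metis
  have gV: "g t \<in> V" if "t \<ge> 0" for t using g[OF that] KV[OF that] by auto
  have gD: "g t \<in> D" if "t \<ge> 0" for t using gV[OF that] VD[of "g t"] \<eta> by auto
  have gI: "cmod (g t) \<ge> t" if t: "t \<ge> 0" for t
  proof -
    have "cmod (g t - Complex \<eta> (R1 + \<eta> + t)) \<le> \<eta> / 4"
      using g[OF t] by (simp add: K_def dist_norm norm_minus_commute)
    then have "\<bar>Im (g t) - (R1 + \<eta> + t)\<bar> \<le> \<eta> / 4"
      using abs_Im_le_cmod[of "g t - Complex \<eta> (R1 + \<eta> + t)"] by auto
    then show ?thesis using abs_Im_le_cmod[of "g t"] R1 \<eta> by linarith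
  qed
  show thesis
  proof (rule that)
    have "dist (g s) (g t) \<le> 2 * dist s t" if st: "s \<ge> 0" "t \<ge> 0" for s t
    proof -
      have "g s - g t = (Complex \<eta> (R1 + \<eta> + s) + e (g s)) - (Complex \<eta> (R1 + \<eta> + t) + e (g t))"
        using g[OF st(1)] g[OF st(2)] by presburger
      also have "\<dots> = \<i> * of_real (s - t) + (e (g s) - e (g t))" by (simp add: complex_eq_iff)
      also have "cmod \<dots> \<le> \<bar>s - t\<bar> + 1 / 2 * cmod (g s - g t)"
      proof (rule order_trans[OF norm_triangle_ineq add_mono])
        show "cmod (\<i> * of_real (s - t)) \<le> \<bar>s - t\<bar>" by (simp only: norm_mult norm_ii norm_of_real mult_1)
        show "cmod (e (g s) - e (g t)) \<le> 1 / 2 * cmod (g s - g t)"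
          by (rule lip[OF gV[OF st(1)] gV[OF st(2)]])
      qed
      finally show ?thesis by (simp add: dist_norm)
    qed
    then have "2-lipschitz_on {0..} g" by (intro lipschitz_onI) auto
    then show "continuous_on {0..} g" by (rule lipschitz_on_continuous_on)
    show "Re (g t) > 0 \<and> cmod (g t) > R \<and> cmod (of_real I * \<Phi> (g t)) = exp (T * Re (g t))" if t: "t \<ge> 0" for t
    proof -
      have nz: "\<Phi> (g t) \<noteq> 0" using pos[OF gD[OF t]] by auto
      \<comment> \<open>The real part of the fixed point equation is the level equation; the
        imaginary part merely parametrizes the curve.\<close>
      have "Re (g t) = \<eta> + Re (e (g t))"
        using arg_cong[OF conjunct2[OF g[OF t]], of Re] by simp
      then have "T * Re (g t) = ln I + ln (cmod (\<Phi> (g t)))"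
        using assms nz by (simp add: e_def \<eta>_def field_simps Re_divide_of_real)
      then have "exp (T * Re (g t)) = I * cmod (\<Phi> (g t))"
        using assms nz by (simp add: exp_add)
      then show ?thesis using gD[OF t] R1 assms by (auto simp: D_def norm_mult)
    qed
    have up: "filterlim (\<lambda>t. cmod (g t)) at_top at_top"
      by (rule filterlim_at_top_mono[OF filterlim_ident])
        (rule eventually_mono[OF eventually_ge_at_top[of 0] gI])
    then show "filterlim g at_infinity at_top" by (simp add: filterlim_at_infinity_conv_norm_at_top)
    have "((\<lambda>t. 2 * C / T / cmod (g t)) \<longlongrightarrow> 0) at_top"
      by (intro tendsto_divide_0[OF tendsto_const] filterlim_at_top_imp_at_infinity up)
    then have "((\<lambda>t. e (g t)) \<longlongrightarrow> 0) at_top"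
      by (rule Lim_null_comparison[rotated])
        (rule eventually_mono[OF eventually_ge_at_top[of 0] eb[OF gD]])
    then have "((\<lambda>t. \<eta> + Re (e (g t))) \<longlongrightarrow> \<eta> + Re 0) at_top"
      by (intro tendsto_intros)
    moreover have "\<forall>\<^sub>F t in at_top. \<eta> + Re (e (g t)) = Re (g t)"
    proof -
      have "\<eta> + Re (e (g t)) = Re (g t)" if "t \<ge> 0" for t
        using arg_cong[OF conjunct2[OF g[OF that]], of Re] by simp
      then show ?thesis by (rule eventually_mono[OF eventually_ge_at_top[of 0]])
    qed
    ultimately show "((\<lambda>t. Re (g t)) \<longlongrightarrow> ln I / T) at_top"
      unfolding \<eta>_def[symmetric] using Lim_transform_eventually by fastforce
  qed
qed

section \<open>Identification of the stability index\<close>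

lemma matrix_inv_eqI:
  fixes A B :: "real^'n^'n"
  assumes "A ** B = mat 1"
  shows "matrix_inv A = B"
proof -
  have "B ** A = mat 1" using assms by (simp add: matrix_left_right_inverse)
  then have "invertible A" using assms unfolding invertible_def by blast
  then have "A ** matrix_inv A = mat 1 \<and> matrix_inv A ** A = mat 1"
    unfolding invertible_def matrix_inv_def by (rule someI_ex)
  then show ?thesis by (metis assms matrix_mul_assoc matrix_mul_lid matrix_mul_rid)
qed

context roll_wave_profile
begin

lemma sonic_fn_eq: "sonic_fn F Hs H = (\<lambda>x. sonic (H x))"
  by (simp add: fun_eq_iff sonic_fn_def dpressure_def sonic_def)

lemma P0_eq: "P0 F Hs H x = vector [vector [fast (H x), - slow (H x)], vector [1, 1]]"
  using F by (simp add: P0_def dpressure_def fast_def slow_def real_sqrt_divide)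

lemma matrix_inv_P0:
  assumes "x \<in> {0..X}"
  defines "s \<equiv> fast (H x) + slow (H x)"
  shows "matrix_inv (P0 F Hs H x) = vector [vector [1 / s, slow (H x) / s], vector [- 1 / s, fast (H x) / s]]"
proof (rule matrix_inv_eqI)
  have "s \<noteq> 0" using fast_plus_slow_pos[OF H_pos[OF assms(1)]] by (simp add: s_def)
  then have "fast (H x) / s + slow (H x) / s = 1"
    by (simp add: s_def add_divide_distrib[symmetric])
  then show "P0 F Hs H x ** vector [vector [1 / s, slow (H x) / s], vector [- 1 / s, fast (H x) / s]] = mat 1"
    unfolding P0_eq
    by (simp add: vec_eq_iff forall_2 matrix_matrix_mult_def sum_2 mat_def add.commute)
qed

lemma vector_derivative_P0:
  assumes "0 < x" "x < X"
  shows "vector_derivative (P0 F Hs H) (at x within {0..X})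
    = vector [vector [fast' (H x), - slow' (H x)], vector [0, 0]]"
proof -
  have xS: "x \<in> {0..X}" using assms by auto
  let ?E = "\<lambda>a b c d. vector [vector [a, b], vector [c, d]] :: real^2^2"
  \<comment> \<open>Splitting into constant matrices with scalar coefficients reduces the derivative
    of the matrix to scalar derivatives.\<close>
  have eq: "P0 F Hs H = (\<lambda>x. fast (H x) *\<^sub>R ?E 1 0 0 0 + slow (H x) *\<^sub>R ?E 0 (-1) 0 0 + ?E 0 0 1 1)"
    by (simp add: fun_eq_iff P0_eq vec_eq_iff forall_2)
  have "(P0 F Hs H has_vector_derivative
      (fast (H x) *\<^sub>R 0 + fast' (H x) *\<^sub>R ?E 1 0 0 0) + (slow (H x) *\<^sub>R 0 + slow' (H x) *\<^sub>R ?E 0 (-1) 0 0) + 0) (at x within {0..X})"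
    unfolding eq by (intro has_vector_derivative_add has_vector_derivative_scaleR has_vector_derivative_const
        DERIV_fast_H DERIV_slow_H xS)
  moreover have "(fast (H x) *\<^sub>R 0 + fast' (H x) *\<^sub>R ?E 1 0 0 0) + (slow (H x) *\<^sub>R 0 + slow' (H x) *\<^sub>R ?E 0 (-1) 0 0) + 0
     = ?E (fast' (H x)) (- slow' (H x)) 0 0"
    by (simp add: vec_eq_iff forall_2)
  ultimately show ?thesis using assms X_pos
    by (simp add: vector_derivative_within_cbox[of 0 X, unfolded box_real])
qed

lemma B1_eq:
  assumes "0 < x" "x < X"
  shows "B1 F Hs X H x = vector [vector [0, 0], vector [src_v (H x), src_h (H x)]]"
proof -
  have xS: "x \<in> {0..X}" using assms by auto
  define u where "u = H x"
  have u: "u > 0" using H_pos[OF xS] by (simp add: u_def)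
  define Q where "Q = discharge F Hs H x"
  have Qu: "Q = c * u - q0" by (simp add: Q_def discharge_def u_def)
  have rh: "deriv (\<lambda>a. source a Q) u = 1 + 2 * Q\<^sup>2 / u ^ 3"
    unfolding source_def using u
    by (intro DERIV_imp_deriv) (auto intro!: derivative_eq_intros simp: field_simps power2_eq_square power3_eq_cube)
  have rq: "deriv (\<lambda>b. source u b) Q = - 2 * Q / u\<^sup>2"
    unfolding source_def using u
    by (intro DERIV_imp_deriv) (auto intro!: derivative_eq_intros simp: field_simps power2_eq_square)
  have "((\<lambda>u. 2 * q0 / u) has_real_derivative - (2 * q0 / (H x)\<^sup>2)) (at (H x))"
    using H_pos[OF xS] by (auto intro!: derivative_eq_intros simp: power2_eq_square)
  from DERIV_comp_H[OF this xS]
  have v1: "vector_derivative (\<lambda>y. 2 * q0 / H y) (at x within {0..X}) = - (2 * q0 / u\<^sup>2) * slope u"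
    using assms X_pos unfolding u_def has_real_derivative_iff_has_vector_derivative
    by (intro vector_derivative_within_cbox[of 0 X, unfolded box_real]) auto
  have v2: "vector_derivative (sonic_fn F Hs H) (at x within {0..X}) = (1 / F\<^sup>2 + 2 * q0\<^sup>2 / u ^ 3) * slope u"
    using assms X_pos DERIV_comp_H[OF DERIV_sonic[OF H_pos[OF xS]] xS]
    unfolding u_def sonic_fn_eq has_real_derivative_iff_has_vector_derivative
    by (intro vector_derivative_within_cbox[of 0 X, unfolded box_real]) auto
  have e1: "- (- 2 * Q / u\<^sup>2) - (- (2 * q0 / u\<^sup>2) * slope u) = src_v u"
    by (simp add: src_v_def Qu diff_divide_distrib)
  have e2: "- ((1 / F\<^sup>2 + 2 * q0\<^sup>2 / u ^ 3) * slope u) + (1 + 2 * Q\<^sup>2 / u ^ 3) + c * (- 2 * Q / u\<^sup>2) = src_h u"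
  proof -
    have "2 * Q\<^sup>2 / u ^ 3 + c * (- 2 * Q / u\<^sup>2) = - (2 * q0 * Q / u ^ 3)"
      using u unfolding Qu by (simp add: field_simps power2_eq_square power3_eq_cube)
    then show ?thesis by (simp add: src_h_def Qu)
  qed
  show ?thesis unfolding B1_def Let_def Q_def[symmetric] u_def[symmetric] rh rq v1 v2 e1 e2 ..
qed

text \<open>The factor m can be split off because the first row of \<open>B1\<close> is zero, which
  leaves \<open>slow\<close> in front of its contribution, and the other contribution has the factor
  m = fast slow from the start.\<close>

lemma C0_11:
  assumes "0 < x" "x < X"
  shows "C0 F Hs X H x $ 1 $ 1 = sonic_fn F Hs H x * coef11 (H x)"
proof -
  have xS: "x \<in> {0..X}" using assms by auto
  define a m where "a = fast (H x)" and "m = slow (H x)"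
  have nz: "a \<noteq> 0" "a + m \<noteq> 0"
    using fast_pos[OF H_pos[OF xS]] fast_plus_slow_pos[OF H_pos[OF xS]] by (auto simp: a_def m_def)
  have "C0 F Hs X H x $ 1 $ 1 = m / (a + m) * src_v (H x) * a + m / (a + m) * src_h (H x)
      - sonic (H x) * (1 / (a + m) * fast' (H x))"
    unfolding C0_def matrix_inv_P0[OF xS] vector_derivative_P0[OF assms] B1_eq[OF assms] sonic_fn_eq
    unfolding P0_eq a_def[symmetric] m_def[symmetric]
    by (simp add: matrix_matrix_mult_def sum_2)
  also have "\<dots> = a * m * coef11 (H x)"
    unfolding coef11_def sonic_eq[OF H_pos[OF xS]] a_def[symmetric] m_def[symmetric]
    unfolding divide_inverse inverse_mult_distrib
    using right_inverse[OF nz(1)] right_inverse[OF nz(2)] by algebra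
  finally show ?thesis by (simp add: sonic_fn_eq sonic_eq[OF H_pos[OF xS]] a_def m_def)
qed

lemma stability_index_eq:
  assumes "is_gamma_plus F Hs X H \<gamma>"
  shows "stability_index F Hs Hm Hp X \<gamma> = index"
proof -
  have xsS: "xs \<in> {0..X}" using xs by auto
  \<comment> \<open>Dividing by m determines \<open>\<gamma>\<close> off the sonic point, and
    \<open>C0_11\<close> covers the open cell; the three excluded points do not affect the
    integral.\<close>
  have "\<gamma> x = coef11 (H x)" if x: "x \<in> {0..X} - {0, xs, X}" for x
  proof -
    have "slow (H x) \<noteq> 0"
      using H_less[of x xs] H_less[of xs x] x xsS slow_neg[of "H x"] slow_pos[of "H x"] H_pos[of x] H_xs
      by (cases "x < xs") auto
    then have "sonic_fn F Hs H x \<noteq> 0"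
      using x H_pos[of x] fast_pos[of "H x"] by (auto simp: sonic_fn_eq sonic_eq)
    moreover have "sonic_fn F Hs H x * coef11 (H x) = sonic_fn F Hs H x * \<gamma> x"
      using C0_11[of x] assms x unfolding is_gamma_plus_def by auto
    ultimately show ?thesis by simp
  qed
  then have "integral {0..X} \<gamma> = growth X" unfolding growth_def
    by (intro integral_spike[of "{0, xs, X}"]) auto
  then show ?thesis by (simp add: stability_index_def index_def fast_def add.commute)
qed

end

theorem theorem1p13:
  fixes F Hs Hm Hp X xs :: real
    and H \<gamma> :: "real \<Rightarrow> real"
    and h q :: "complex \<Rightarrow> real \<Rightarrow> complex"
  assumes "F > 2"
    and "roll_wave F Hs Hm Hp X H"
    and "0 < xs" and "xs < X" and "H xs = Hs"
    and "normalized_solution F Hs X H xs h q"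
    and "is_gamma_plus F Hs X H \<gamma>"
  shows "bounded (Re ` unstable_spectrum F Hs X H h q) \<and>
    (stability_index F Hs Hm Hp X \<gamma> < 1 \<longrightarrow>
      bounded (unstable_spectrum F Hs X H h q)) \<and>
    (stability_index F Hs Hm Hp X \<gamma> > 1 \<longrightarrow>
      (\<exists>\<eta>>0. \<exists>g :: real \<Rightarrow> complex.
        continuous_on {0..} g \<and>
        (\<forall>t\<ge>0. g t \<in> unstable_spectrum F Hs X H h q) \<and>
        filterlim g at_infinity at_top \<and>
        ((\<lambda>t. Re (g t)) \<longlongrightarrow> \<eta>) at_top))"
proof -
  interpret roll_wave_profile F Hs Hm Hp X xs H
    using assms by unfold_locales auto
  define T where "T = phase X"
  have T: "T > 0" using phase_X_pos by (simp add: T_def)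
  define E where "E z x = evans_flux z (h z) (q z) x" for z x
  have dom: "z \<in> spectral_domain F Hs" if "Re z > 0" for z
  proof -
    have "- (F - 2) / (2 * sqrt Hs) < 0" using F Hs_pos by (simp add: divide_less_0_iff)
    then show ?thesis using that by (simp add: spectral_domain_def)
  qed
  have sol: "real_analytic_on (h z) {0..X}" "real_analytic_on (q z) {0..X}"
    "eigen_system F Hs X H z (h z) (q z)" "h z xs \<noteq> 0" if z: "Re z > 0" for z
  proof -
    have ns: "real_analytic_on (h z) {0..X}" "real_analytic_on (q z) {0..X}" "eigen_system F Hs X H z (h z) (q z)"
      "h z xs = of_real ((F - 2) / (2 * (F + 1)) * sqrt Hs) * ((z + of_real (2/3 * ((F + 1) / sqrt Hs))) * of_real F)"
      using assms(6) dom[OF z] unfolding normalized_solution_def by auto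
    show "real_analytic_on (h z) {0..X}" "real_analytic_on (q z) {0..X}" "eigen_system F Hs X H z (h z) (q z)"
      by (fact ns)+
    \<comment> \<open>The normalizing factor z + 2/3 (F + 1) / sqrt Hs has positive real part, so h
      cannot vanish at the sonic point.\<close>
    have "2/3 * ((F + 1) / sqrt Hs) > 0" using F Hs_pos by simp
    then have "Re (z + of_real (2/3 * ((F + 1) / sqrt Hs))) > 0" using z by simp
    then have "z + of_real (2/3 * ((F + 1) / sqrt Hs)) \<noteq> 0" by (metis less_irrefl zero_complex.simps(1))
    moreover have "(F - 2) / (2 * (F + 1)) * sqrt Hs \<noteq> 0" using F Hs_pos by simp
    ultimately show "h z xs \<noteq> 0" unfolding ns(4) using F
      by (metis less_numeral_extra(3) mult_eq_0_iff of_real_eq_0_iff order_less_trans zero_less_numeral)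
  qed
  have iff: "z \<in> unstable_spectrum F Hs X H h q \<longleftrightarrow> Re z > 0 \<and> cmod (E z X) = cmod (E z 0)" for z
  proof (cases "Re z > 0")
    case True
    then have z0: "z \<noteq> 0" by auto
    have ch: "continuous_on {0..X} (h z)" using sol(1)[OF True] by (rule real_analytic_on_imp_C1)
    have cq: "continuous_on {0..X} (q z)" using sol(2)[OF True] by (rule real_analytic_on_imp_C1)
    have "evans_lopatinsky F Hs X H h q z \<xi> = 0 \<longleftrightarrow> E z X = exp (\<i> * of_real (\<xi> * X)) * E z 0" for \<xi>
      unfolding evans_lopatinsky_eq[where h = h and q = q, OF z0 ch cq] E_def using z0 Hm_less Hp_gt by auto
    then show ?thesis unfolding unstable_spectrum_def using True exists_rotation_iff by simp
  qed (simp add: unstable_spectrum_def)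
  obtain C R where CR: "C > 0" "R > 0" and asy:
    "\<And>l h q. Re l \<ge> 0 \<Longrightarrow> cmod l \<ge> R \<Longrightarrow> real_analytic_on h {0..X} \<Longrightarrow> real_analytic_on q {0..X} \<Longrightarrow>
      eigen_system F Hs X H l h q \<Longrightarrow> h xs \<noteq> 0 \<Longrightarrow>
      evans_flux l h q X \<noteq> 0 \<and>
      cmod (evans_flux l h q 0 / evans_flux l h q X * exp (l * of_real (phase X)) / of_real index - 1) \<le> C / cmod l"
    using index_asymptotics by blast
  define \<Phi> where "\<Phi> z = E z 0 / E z X * exp (z * of_real T) / of_real index" for z
  have nz: "E z X \<noteq> 0" and bd: "cmod (\<Phi> z - 1) \<le> C / cmod z" if "Re z > 0" "cmod z > R" for z
    using asy[OF _ _ sol[OF that(1)]] that by (auto simp: \<Phi>_def E_def T_def)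
  have mod: "index * cmod (\<Phi> z) = cmod (E z 0) / cmod (E z X) * exp (T * Re z)" for z
    using index_pos by (simp add: \<Phi>_def norm_mult norm_divide mult.commute)
  \<comment> \<open>For an eigenvalue |E (0) / E (X)| = 1, so the modulus of I \<open>\<Phi>\<close>
    is exactly exp (T Re z).\<close>
  have large: "exp (T * Re z) \<le> index * (1 + C / cmod z)"
    if z: "z \<in> unstable_spectrum F Hs X H h q" "cmod z > R" for z
  proof -
    have z': "Re z > 0" "cmod (E z X) = cmod (E z 0)" using z iff by auto
    have "E z 0 \<noteq> 0" using nz[OF z'(1) z(2)] z'(2) by (metis norm_eq_zero)
    then have "index * cmod (\<Phi> z) = exp (T * Re z)" unfolding mod z'(2) by simp
    moreover have "cmod (\<Phi> z) \<le> 1 + C / cmod z"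
      using bd[OF z'(1) z(2)] norm_triangle_sub[of "\<Phi> z" 1] by simp
    ultimately show ?thesis using index_pos by (metis mult_left_mono less_imp_le)
  qed
  \<comment> \<open>The 1 added inside \<open>ln\<close> keeps the second summand nonnegative, so
    one bound covers |z| at most \<open>R\<close> as well.\<close>
  have "\<bar>Re z\<bar> \<le> R + ln (index * (1 + C / R) + 1) / T" if z: "z \<in> unstable_spectrum F Hs X H h q" for z
  proof -
    have i1: "index * (1 + C / R) > 0" using index_pos CR by (simp add: add_pos_pos)
    have l0: "ln (index * (1 + C / R) + 1) / T \<ge> 0" using i1 T by simp
    show ?thesis
    proof (cases "cmod z > R")
      case True
      have "exp (T * Re z) \<le> index * (1 + C / cmod z)" by (rule large[OF z True])
      also have "\<dots> \<le> index * (1 + C / R)"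
        using CR True index_pos by (intro mult_left_mono add_left_mono divide_left_mono mult_pos_pos) auto
      finally have "exp (T * Re z) \<le> index * (1 + C / R) + 1" by simp
      then have "T * Re z \<le> ln (index * (1 + C / R) + 1)" using i1 by (simp add: ln_ge_iff)
      then have "Re z \<le> ln (index * (1 + C / R) + 1) / T" using T by (simp add: field_simps)
      then show ?thesis using z iff CR by (simp add: unstable_spectrum_def)
    next
      case False
      then show ?thesis using l0 abs_Re_le_cmod[of z] by linarith
    qed
  qed
  then have 1: "bounded (Re ` unstable_spectrum F Hs X H h q)"
    unfolding bounded_iff by auto
  have 2: "bounded (unstable_spectrum F Hs X H h q)" if "index < 1"
  proof -
    have "cmod z \<le> R + C * index / (1 - index)" if z: "z \<in> unstable_spectrum F Hs X H h q" for z
    proof (cases "cmod z > R")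
      case True
      \<comment> \<open>An unstable eigenvalue forces 1 to be at most I (1 + C / |z|), which for I <
        1 is possible only for bounded |z|.\<close>
      have "1 \<le> exp (T * Re z)" using z iff T by simp
      also have "\<dots> \<le> index * (1 + C / cmod z)" by (rule large[OF z True])
      finally have "1 \<le> index * (1 + C / cmod z)" .
      moreover have "cmod z > 0" using True CR by linarith
      ultimately have "cmod z * (1 - index) \<le> C * index" by (simp add: field_simps)
      then have "cmod z \<le> C * index / (1 - index)" using \<open>index < 1\<close> by (simp add: field_simps)
      then show ?thesis using CR by simp
    next
      case False
      have "C * index / (1 - index) \<ge> 0" using CR index_pos \<open>index < 1\<close> by simp
      then show ?thesis using False by linarith
    qed
    then show ?thesis unfolding bounded_iff by blast
  qed
  have 3: "\<exists>\<eta>>0. \<exists>g :: real \<Rightarrow> complex. continuous_on {0..} g \<and>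
        (\<forall>t\<ge>0. g t \<in> unstable_spectrum F Hs X H h q) \<and>
        filterlim g at_infinity at_top \<and> ((\<lambda>t. Re (g t)) \<longlongrightarrow> \<eta>) at_top" if I: "index > 1"
  proof -
    \<comment> \<open>Analytic dependence of the normalized solution on z makes
      \<open>\<Phi>\<close> holomorphic, as the construction of the level curve requires.\<close>
    have hol: "(\<lambda>z. E z x) holomorphic_on {z. Re z > 0 \<and> cmod z > R}" if "x \<in> {0..X}" for x
    proof -
      have "(\<lambda>z. h z x) analytic_on spectral_domain F Hs" "(\<lambda>z. q z x) analytic_on spectral_domain F Hs"
        using assms(6) that unfolding normalized_solution_def by auto
      then have "(\<lambda>z. h z x) holomorphic_on {z. Re z > 0 \<and> cmod z > R}" "(\<lambda>z. q z x) holomorphic_on {z. Re z > 0 \<and> cmod z > R}"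
        using dom by (auto intro!: holomorphic_on_subset[OF analytic_imp_holomorphic])
      then show ?thesis unfolding E_def evans_flux_def by (intro holomorphic_intros) auto
    qed
    have "\<Phi> holomorphic_on {z. Re z > 0 \<and> cmod z > R}"
      unfolding \<Phi>_def using nz index_pos X_pos by (intro holomorphic_intros hol) auto
    then obtain g :: "real \<Rightarrow> complex" where g: "continuous_on {0..} g"
      "\<And>t. t \<ge> 0 \<Longrightarrow> Re (g t) > 0 \<and> cmod (g t) > R \<and> cmod (of_real index * \<Phi> (g t)) = exp (T * Re (g t))"
      "filterlim g at_infinity at_top" "((\<lambda>t. Re (g t)) \<longlongrightarrow> ln index / T) at_top"
      using unbounded_level_curve[OF I T CR(1) _ bd] by blast
    have "g t \<in> unstable_spectrum F Hs X H h q" if t: "t \<ge> 0" for t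
    proof -
      have "cmod (E (g t) 0) / cmod (E (g t) X) * exp (T * Re (g t)) = exp (T * Re (g t))"
        using g(2)[OF t] index_pos unfolding mod[symmetric] by (simp add: norm_mult)
      then have "cmod (E (g t) 0) / cmod (E (g t) X) = 1"
        by (metis exp_not_eq_zero mult_1 mult_cancel_right)
      then show ?thesis using g(2)[OF t] nz[of "g t"] by (simp add: iff)
    qed
    moreover have "ln index / T > 0" using I T by simp
    ultimately show ?thesis using g by blast
  qed
  show ?thesis using 1 2 3 unfolding stability_index_eq[OF assms(7)] by blast
qed

end
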